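(* Let $\rho_j=\sigma_j+it_j$ be zeros of $Z_F$ with $\sigma_j\uparrow\sigma_F$, and put $\varepsilon_j=\sigma_F-\sigma_j$. Then, as $j\to\infty$, $$2^{-it_j},\ 3^{-it_j},\ 8^{-it_j}\longrightarrow-1,\qquad 144^{-it_j}\longrightarrow+1,$$ and $F_n^{-it_j}\to-1$ for every fixed $n\ge3$, $n\ne12$. More quantitatively, if $$0<c<\frac1{\sigma_F\log\varphi}=2.7962718895\ldots,$$ then $$\max_{\substack{3\le n\le c\log(1/\varepsilon_j)\\ n\ne12}}|F_n^{-it_j}+1|=O_c\!\left(\varepsilon_j^{(1-c\sigma_F\log\varphi)/2}\right).$$
   Context: $F_1=F_2=1$, $F_{n+2}=F_{n+1}+F_n$ are the Fibonacci numbers, $\varphi=(1+\sqrt5)/2$, and $Z_F(s)=\sum_{n\ge1}F_n^{-s}$ for $\operatorname{Re}s>0$. $\sigma_F=0.7431\ldots$ is the unique number in $(0.7,0.75)$ with $Z_F(\sigma_F)=4+2\cdot144^{-\sigma_F}$; $Z_F$ has no zeros with $\operatorname{Re}s\ge\sigma_F$, so $\varepsilon_j>0$. The $O_c$ is as $j\to\infty$, with implied constant depending only on $c$. *)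

theory Defs
  imports "HOL-Analysis.Analysis" "HOL-Number_Theory.Fib"
begin

definition phi :: real where
  "phi = (1 + sqrt 5) / 2"

text \<open>The series runs over \<open>n \<ge> 1\<close>, hence the shift by \<open>Suc\<close>
  (\<open>fib 0 = 0\<close>, \<open>fib 1 = fib 2 = 1\<close>). It converges only for \<open>Re s > 0\<close>; elsewhere the value
  is meaningless, so every use below is restricted to that half-plane.\<close>

definition Z_F :: "complex \<Rightarrow> complex" where
  "Z_F s = (\<Sum>n. of_nat (fib (Suc n)) powr (- s))"

definition sigma_F :: real where
  "sigma_F = (THE x. 0.7 < x \<and> x < 0.75 \<and>
     Z_F (of_real x) = 4 + 2 * of_real (144 powr (- x)))"

text \<open>Zeros \<open>\<rho>\<^sub>j\<close> in the half-plane \<open>Re s > 0\<close> with \<open>Re \<rho>\<^sub>j \<up> \<sigma>\<^sub>F\<close>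
  (monotone, not necessarily strictly).\<close>

definition zeros_increasing_to_sigma_F :: "(nat \<Rightarrow> complex) \<Rightarrow> bool" where
  "zeros_increasing_to_sigma_F \<rho> \<longleftrightarrow>
     (\<forall>j. Re (\<rho> j) > 0 \<and> Z_F (\<rho> j) = 0) \<and>
     incseq (\<lambda>j. Re (\<rho> j)) \<and> (\<lambda>j. Re (\<rho> j)) \<longlonglongrightarrow> sigma_F"

definition eps :: "complex \<Rightarrow> real" where
  "eps z = sigma_F - Re z"

text \<open>The number \<open>m\<^bsup>-it\<^esup>\<close>, where \<open>t = Im z\<close>.\<close>

definition phase :: "nat \<Rightarrow> complex \<Rightarrow> complex" where
  "phase m z = of_nat m powr (- (\<i> * of_real (Im z)))"

definition index_range :: "real \<Rightarrow> complex \<Rightarrow> nat set" where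
  "index_range c z = {n. 3 \<le> n \<and> real n \<le> c * ln (1 / eps z) \<and> n \<noteq> 12}"

end

theory Submission
  imports Defs
begin

text \<open>
  Let \<open>D(p) = \<Sum>\<^sub>n w\<^sub>n F\<^sub>n\<^sup>-\<^sup>p\<close> over \<open>n \<ge> 1\<close>, with \<open>w\<^sub>1\<^sub>2 = -1\<close> and \<open>w\<^sub>n = 1\<close> otherwise; then
  \<open>\<sigma>\<^sub>F\<close> is the solution of \<open>D(p) = 4\<close>. At a zero \<open>\<sigma> + it\<close> the real part of \<open>Z\<^sub>F\<close> vanishes, which
  gives, with \<open>\<theta>\<^sub>n = t log F\<^sub>n\<close>,
  \<open>D(\<sigma>) - 4 = \<Sum>\<^sub>n F\<^sub>n\<^sup>-\<^sup>\<sigma> (1 + cos \<theta>\<^sub>n) - F\<^sub>1\<^sub>2\<^sup>-\<^sup>\<sigma> (1 - cos \<theta>\<^sub>1\<^sub>2)\<close>, the sum being over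
  \<open>n \<ge> 3\<close>, \<open>n \<noteq> 12\<close>. Since \<open>144 = 2\<^sup>4 3\<^sup>2\<close>, the negative term is absorbed by the terms of \<open>2\<close> and
  \<open>3\<close>, so every \<open>F\<^sub>n\<^sup>-\<^sup>\<sigma> (1 + cos \<theta>\<^sub>n)\<close> is \<open>O(D(\<sigma>) - 4) = O(\<epsilon>)\<close>, and
  \<open>F\<^sub>n \<le> \<phi>\<^sup>n\<close> turns this into the stated rate. On the line \<open>\<sigma> = \<sigma>\<^sub>F\<close> all these phases would be \<open>-1\<close>,
  which Cassini's identity \<open>F\<^sub>n F\<^sub>n\<^sub>+\<^sub>2 = F\<^sub>n\<^sub>+\<^sub>1\<^sup>2 \<plusminus> 1\<close> only allows for \<open>t = 0\<close>. The decimals of the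
  exponent come from fixed-point evaluations of \<open>D\<close> on both sides of \<open>\<sigma>\<^sub>F\<close>.
\<close>

subsection \<open>Fixed-point enclosures\<close>

text \<open>Reals are scaled by 10^18 and rounded to integers, a margin of several digits over the
  endpoints with at most 12 decimals used below.\<close>

definition scale :: int where "scale = 10 ^ 18"

lemma scale_pos: "0 < scale"
  by (simp add: scale_def)

text \<open>A nonnegative lower end makes products and quotients monotone in the end points, so no
  sign cases arise.\<close>

definition encl :: "int \<times> int \<Rightarrow> real \<Rightarrow> bool" where
  "encl I y \<longleftrightarrow> 0 \<le> fst I \<and> of_int (fst I) \<le> of_int scale * y \<and> of_int scale * y \<le> of_int (snd I)"

text \<open>Integer division rounds down; the added 1 turns the floor into a valid upper
  end.\<close>

definition iquot :: "int \<Rightarrow> int \<Rightarrow> int \<times> int" where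
  "iquot a b = (a * scale div b, a * scale div b + 1)"

fun imul :: "int \<times> int \<Rightarrow> int \<times> int \<Rightarrow> int \<times> int" where
  "imul (a, b) (c, d) = (a * c div scale, b * d div scale + 1)"

fun idiv :: "int \<times> int \<Rightarrow> int \<times> int \<Rightarrow> int \<times> int" where
  "idiv (a, b) (c, d) = (a * scale div d, b * scale div c + 1)"

lemma of_int_div_upper: "real_of_int a / real_of_int b \<le> real_of_int (a div b + 1)"
  using real_of_int_div3[of a b] by simp

lemma encl_iquot:
  assumes "0 \<le> a" "0 < b"
  shows "encl (iquot a b) (of_int a / of_int b)"
proof -
  have "of_int scale * (of_int a / of_int b) = real_of_int (a * scale) / of_int b" by simp
  then show ?thesis
    using assms scale_pos real_of_int_div4[of "a * scale" b] of_int_div_upper[of "a * scale" b]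
    by (simp add: encl_def iquot_def pos_imp_zdiv_nonneg_iff mult.commute)
qed

lemma encl_imul:
  assumes "encl I x" "encl J y"
  shows "encl (imul I J) (x * y)"
proof -
  obtain a b c d where IJ: "I = (a, b)" "J = (c, d)" by fastforce
  define X Y where "X = of_int scale * x" and "Y = of_int scale * y"
  have h: "0 \<le> a" "0 \<le> c" "of_int a \<le> X" "X \<le> of_int b" "of_int c \<le> Y" "Y \<le> of_int d"
    using assms by (auto simp: encl_def IJ X_def Y_def)
  have XY: "X * Y / of_int scale = of_int scale * (x * y)"
    using scale_pos by (simp add: X_def Y_def)
  have "real_of_int (a * c div scale) \<le> of_int (a * c) / of_int scale"
    by (rule real_of_int_div4)
  also have "\<dots> \<le> X * Y / of_int scale"
    using h scale_pos by (auto intro!: divide_right_mono mult_mono)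
  finally have lo: "real_of_int (a * c div scale) \<le> of_int scale * (x * y)" by (simp only: XY)
  have "X * Y / of_int scale \<le> of_int (b * d) / of_int scale"
    using h scale_pos by (auto intro!: divide_right_mono mult_mono)
  also have "\<dots> \<le> of_int (b * d div scale + 1)" by (rule of_int_div_upper)
  finally have "of_int scale * (x * y) \<le> of_int (b * d div scale + 1)" by (simp only: XY)
  with lo h scale_pos show ?thesis
    by (simp add: encl_def IJ pos_imp_zdiv_nonneg_iff)
qed

lemma encl_idiv:
  assumes "encl I x" "encl J y" "0 < fst J"
  shows "encl (idiv I J) (x / y)"
proof -
  obtain a b c d where IJ: "I = (a, b)" "J = (c, d)" by fastforce
  define X Y where "X = of_int scale * x" and "Y = of_int scale * y"
  have h: "0 \<le> a" "0 < c" "of_int a \<le> X" "X \<le> of_int b" "of_int c \<le> Y" "Y \<le> of_int d"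
    using assms by (auto simp: encl_def IJ X_def Y_def)
  have Y: "0 < Y" and d: "0 < d"
    using h(2,5,6) by linarith+
  have XY: "X * of_int scale / Y = of_int scale * (x / y)"
    using scale_pos by (simp add: X_def Y_def)
  have "real_of_int (a * scale div d) \<le> of_int (a * scale) / of_int d"
    by (rule real_of_int_div4)
  also have "\<dots> \<le> X * of_int scale / Y"
    using h Y d scale_pos by (auto intro!: frac_le mult_mono)
  finally have lo: "real_of_int (a * scale div d) \<le> of_int scale * (x / y)" by (simp only: XY)
  have "X * of_int scale / Y \<le> of_int (b * scale) / of_int c"
    using h Y d scale_pos by (auto intro!: frac_le mult_mono)
  also have "\<dots> \<le> of_int (b * scale div c + 1)" by (rule of_int_div_upper)
  finally have "of_int scale * (x / y) \<le> of_int (b * scale div c + 1)" by (simp only: XY)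
  with lo h d scale_pos show ?thesis
    by (simp add: encl_def IJ pos_imp_zdiv_nonneg_iff)
qed

section \<open>Horner remainders of the binomial series\<close>

text \<open>The hypergeometric series 2F1(p+j, 1; 1+j; w). For j = 0 it is the binomial series of
  \<open>(1 - w) powr (- p)\<close>; larger j give its Horner remainders.\<close>

definition binomial_tail :: "real \<Rightarrow> real \<Rightarrow> nat \<Rightarrow> real" where
  "binomial_tail p w j = (\<Sum>k. pochhammer (p + real j) k / pochhammer (1 + real j) k * w ^ k)"

text \<open>For p <= 1 each factor p+j+i is at most 1+j+i. Hence the geometric series dominates,
  uniformly in j.\<close>

lemma pochhammer_quotient_bounds:
  fixes p :: real
  assumes "0 \<le> p" "p \<le> 1"
  shows "0 \<le> pochhammer (p + real j) k / pochhammer (1 + real j) k"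
    and "pochhammer (p + real j) k / pochhammer (1 + real j) k \<le> 1"
proof -
  have pos: "0 < pochhammer (1 + real j) k" by (rule pochhammer_pos) simp
  have "0 \<le> pochhammer (p + real j) k" "pochhammer (p + real j) k \<le> pochhammer (1 + real j) k"
    unfolding pochhammer_prod using assms by (auto intro!: prod_nonneg prod_mono)
  with pos show "0 \<le> pochhammer (p + real j) k / pochhammer (1 + real j) k"
    and "pochhammer (p + real j) k / pochhammer (1 + real j) k \<le> 1"
    by auto
qed

context
  fixes p w :: real
  assumes p: "0 \<le> p" "p \<le> 1" and w: "0 \<le> w" "w < 1"
begin

lemma summable_binomial_tail:
  "summable (\<lambda>k. pochhammer (p + real j) k / pochhammer (1 + real j) k * w ^ k)"
proof (rule summable_comparison_test')
  show "summable (\<lambda>k. w ^ k)" using w by (simp add: summable_geometric)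
  show "norm (pochhammer (p + real j) k / pochhammer (1 + real j) k * w ^ k) \<le> w ^ k"
    if "k \<ge> 0" for k
    using pochhammer_quotient_bounds[OF p, of j k] w
    by (simp add: abs_mult mult_left_le_one_le del: times_divide_eq_left)
qed

text \<open>The Horner step: after the term k = 0 is split off, pulling one factor out of both
  Pochhammer symbols leaves the same series with j+1.\<close>

lemma binomial_tail_rec:
  "binomial_tail p w j = 1 + (p + real j) / (1 + real j) * w * binomial_tail p w (Suc j)"
proof -
  have "binomial_tail p w j = (\<Sum>k. pochhammer (p + real j) (Suc k) / pochhammer (1 + real j) (Suc k) * w ^ Suc k) + 1"
    unfolding binomial_tail_def using suminf_split_head[OF summable_binomial_tail, of j] by simp
  also have "(\<lambda>k. pochhammer (p + real j) (Suc k) / pochhammer (1 + real j) (Suc k) * w ^ Suc k) =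
      (\<lambda>k. ((p + real j) / (1 + real j) * w) * (pochhammer (p + real (Suc j)) k / pochhammer (1 + real (Suc j)) k * w ^ k))"
    by (simp add: pochhammer_rec fun_eq_iff add_ac)
  also have "(\<Sum>k. ((p + real j) / (1 + real j) * w) * (pochhammer (p + real (Suc j)) k / pochhammer (1 + real (Suc j)) k * w ^ k)) =
      (p + real j) / (1 + real j) * w * binomial_tail p w (Suc j)"
    unfolding binomial_tail_def by (rule suminf_mult[OF summable_binomial_tail])
  finally show ?thesis by simp
qed

lemma binomial_tail_bounds: "1 \<le> binomial_tail p w j" "binomial_tail p w j \<le> 1 / (1 - w)"
proof -
  have "sum (\<lambda>k. pochhammer (p + real j) k / pochhammer (1 + real j) k * w ^ k) {..<1} \<le> binomial_tail p w j"
    unfolding binomial_tail_def using w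
    by (intro sum_le_suminf summable_binomial_tail ballI mult_nonneg_nonneg
        pochhammer_quotient_bounds[OF p]) auto
  then show "1 \<le> binomial_tail p w j" by simp
  have "binomial_tail p w j \<le> (\<Sum>k. w ^ k)"
    unfolding binomial_tail_def using w pochhammer_quotient_bounds[OF p, of j]
    by (intro suminf_le summable_binomial_tail summable_geometric)
       (auto simp: mult_left_le_one_le simp del: times_divide_eq_left)
  also have "\<dots> = 1 / (1 - w)" using w by (simp add: suminf_geometric)
  finally show "binomial_tail p w j \<le> 1 / (1 - w)" .
qed

text \<open>Newton's series with exponent -p at -w; the signs of the coefficients and of the powers
  cancel.\<close>

lemma binomial_tail_0: "binomial_tail p w 0 = (1 - w) powr (- p)"
proof -
  have "(\<lambda>n. (- p gchoose n) * (- w) ^ n) sums (1 + (- w)) powr (- p)"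
    using w by (intro gen_binomial_real) auto
  moreover have "(- p gchoose n) * (- w) ^ n = pochhammer p n / pochhammer 1 n * w ^ n" for n
  proof -
    have "(- p gchoose n) * (- w) ^ n = ((- 1) ^ n * (- 1) ^ n) * (pochhammer p n / fact n * w ^ n)"
      unfolding gbinomial_pochhammer power_minus[of w n] by simp
    also have "(- 1) ^ n * (- 1 :: real) ^ n = 1" by (simp flip: power_mult_distrib)
    finally show ?thesis by (simp add: pochhammer_fact)
  qed
  ultimately show ?thesis
    unfolding binomial_tail_def by (simp add: sums_iff)
qed

end

text \<open>Horner evaluation of the binomial series with all signs positive; the innermost value is
  bounded by the geometric series.\<close>

fun binomial_encl :: "int \<Rightarrow> int \<Rightarrow> int \<Rightarrow> int \<Rightarrow> nat \<Rightarrow> int \<times> int" where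
  "binomial_encl P Q d j 0 = (scale, snd (iquot d (d - 1)))"
| "binomial_encl P Q d j (Suc m) =
    (let (l, u) = imul (iquot (P + j * Q) ((j + 1) * Q * d)) (binomial_encl P Q d (j + 1) m)
     in (scale + l, scale + u))"

lemma encl_binomial_encl:
  assumes PQ: "0 \<le> P" "P \<le> Q" "0 < Q" and d: "2 \<le> d"
  shows "encl (binomial_encl P Q d (int j) m) (binomial_tail (P / Q) (1 / d) j)"
proof (induction m arbitrary: j)
  case 0
  have pw: "0 \<le> real_of_int P / Q" "real_of_int P / Q \<le> 1" "0 \<le> 1 / real_of_int d" "1 / real_of_int d < 1"
    using PQ d by auto
  have eq: "1 / (1 - 1 / real_of_int d) = of_int d / of_int (d - 1)"
    using d by (simp add: field_simps)
  have "of_int scale * binomial_tail (P / Q) (1 / d) j \<le> of_int scale * (of_int d / of_int (d - 1))"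
    using binomial_tail_bounds(2)[OF pw, of j] scale_pos unfolding eq by (intro mult_left_mono) auto
  also have "\<dots> \<le> of_int (snd (iquot d (d - 1)))"
    using encl_iquot[of d "d - 1"] d by (simp add: encl_def)
  finally show ?case
    using binomial_tail_bounds(1)[OF pw, of j] scale_pos by (simp add: encl_def)
next
  case (Suc m)
  have pw: "0 \<le> real_of_int P / Q" "real_of_int P / Q \<le> 1" "0 \<le> 1 / real_of_int d" "1 / real_of_int d < 1"
    using PQ d by auto
  have "encl (iquot (P + int j * Q) ((int j + 1) * Q * d))
      (of_int (P + int j * Q) / of_int ((int j + 1) * Q * d))"
    using PQ d by (intro encl_iquot) auto
  also have "real_of_int (P + int j * Q) / of_int ((int j + 1) * Q * d) = (P / Q + real j) / (1 + real j) * (1 / d)"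
    using PQ by (simp add: field_simps)
  finally have "encl (imul (iquot (P + int j * Q) ((int j + 1) * Q * d)) (binomial_encl P Q d (int (Suc j)) m))
      ((P / Q + real j) / (1 + real j) * (1 / d) * binomial_tail (P / Q) (1 / d) (Suc j))"
    using Suc.IH by (rule encl_imul)
  then show ?case
    using scale_pos
    by (subst binomial_tail_rec[OF pw]) (auto simp: encl_def algebra_simps split: prod.splits)
qed

text \<open>The lower end is \<open>scale\<close> plus a nonnegative number. This permits division
  by the enclosure.\<close>

lemma fst_binomial_encl_pos:
  assumes "0 \<le> P" "P \<le> Q" "0 < Q" "2 \<le> d"
  shows "0 < fst (binomial_encl P Q d (int j) m)"
proof (cases m)
  case (Suc k)
  have "encl (imul (iquot (P + int j * Q) ((int j + 1) * Q * d)) (binomial_encl P Q d (int (Suc j)) k))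
     (of_int (P + int j * Q) / of_int ((int j + 1) * Q * d) * binomial_tail (P / Q) (1 / d) (Suc j))"
    using assms by (intro encl_imul encl_iquot encl_binomial_encl) auto
  then show ?thesis using scale_pos by (auto simp: Suc encl_def add_ac split: prod.splits)
qed (simp add: scale_pos)

text \<open>The state at index \<open>n\<close> consists of \<open>F\<^sub>n\<close>, \<open>F\<^sub>n\<^sub>+\<^sub>1\<close> and enclosures of the partial sum,
  of \<open>F\<^sub>n\<^sup>-\<^sup>p\<close>, and of the ratios to the next and from the previous term. The ratio
  is updated by the factor \<open>(F\<^sub>n F\<^sub>n\<^sub>+\<^sub>2 / F\<^sub>n\<^sub>+\<^sub>1\<^sup>2)\<^sup>-\<^sup>p\<close>, which is close to \<open>1\<close> by Cassini's identity.\<close>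

fun fib_run :: "int \<Rightarrow> int \<Rightarrow> int \<Rightarrow> int \<Rightarrow> int \<times> int \<Rightarrow> int \<times> int \<Rightarrow> int \<times> int \<Rightarrow> int \<times> int \<Rightarrow>
    nat list \<Rightarrow> (int \<times> int) \<times> (int \<times> int) \<times> (int \<times> int) \<times> (int \<times> int)" where
  "fib_run P Q f g s X R R' [] = (s, X, R, R')"
| "fib_run P Q f g s X R R' (m # ms) =
    (let h = f + g in
     fib_run P Q g h
       (if f = 144 then (fst s - snd X, snd s - fst X) else (fst s + fst X, snd s + snd X))
       (imul X R)
       (if f * h < g * g then imul R (binomial_encl P Q (g * g) 0 m)
        else idiv R (binomial_encl P Q (f * h) 0 m))
       R ms)"

text \<open>The \<open>n\<close>-th entry \<open>m\<close> is the number of binomial terms for the step from \<open>n\<close> to \<open>n + 1\<close>, chosen such that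
  \<open>w\<^sup>m \<le> 10\<^sup>-\<^sup>1\<^sup>3\<close>, where \<open>w = 1 / max (F\<^sub>n F\<^sub>n\<^sub>+\<^sub>2) F\<^sub>n\<^sub>+\<^sub>1\<^sup>2\<close> is the argument of the series.\<close>

definition series_lengths :: "nat list" where
  "series_lengths = [44, 22, 13, 10, 8, 6, 5, 5, 4, 4, 4, 3, 3, 3, 3, 3, 2, 2, 2, 2, 2, 2]"

subsection \<open>The weighted Fibonacci sum\<close>

text \<open>Since \<open>0 powr x = 0\<close>, the term at n = 0 vanishes, and sums over all
  naturals agree with sums over n >= 1.\<close>

definition fib_term :: "real \<Rightarrow> nat \<Rightarrow> real" where
  "fib_term p n = real (fib n) powr (- p)"

definition fib_weight :: "nat \<Rightarrow> real" where
  "fib_weight n = (if n = 12 then - 1 else 1)"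

definition fib_sum :: "real \<Rightarrow> real" where
  "fib_sum p = (\<Sum>n. fib_weight n * fib_term p n)"

lemma fib_term_nonneg: "0 \<le> fib_term p n"
  by (simp add: fib_term_def)

lemma fib_pos: "0 < n \<Longrightarrow> 0 < real (fib n)"
  by (simp add: fib_neq_0_nat)

lemma fib_term_step:
  assumes "0 < n"
  shows "fib_term p (Suc n) = fib_term p n * (real (fib (Suc n)) / real (fib n)) powr (- p)"
  using fib_pos[OF assms] by (simp add: fib_term_def powr_mult[symmetric])

section \<open>Consecutive ratios and geometric tails\<close>

text \<open>The inequality is linear in the Fibonacci numbers, so adding two consecutive instances
  yields the next one.\<close>

lemma fib_ratio_le:
  fixes r :: real
  assumes "fib (Suc m) \<le> r * fib m" "fib (Suc (Suc m)) \<le> r * fib (Suc m)"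
  shows "fib (Suc (m + k)) \<le> r * fib (m + k)"
proof -
  have "fib (Suc (m + k)) \<le> r * fib (m + k) \<and> fib (Suc (Suc (m + k))) \<le> r * fib (Suc (m + k))"
  proof (induction k)
    case (Suc k)
    then show ?case by (simp add: algebra_simps)
  qed (use assms in auto)
  then show ?thesis ..
qed

lemma fib_ratio_ge:
  fixes r :: real
  assumes "r * fib m \<le> fib (Suc m)" "r * fib (Suc m) \<le> fib (Suc (Suc m))"
  shows "r * fib (m + k) \<le> fib (Suc (m + k))"
proof -
  have "r * fib (m + k) \<le> fib (Suc (m + k)) \<and> r * fib (Suc (m + k)) \<le> fib (Suc (Suc (m + k)))"
  proof (induction k)
    case (Suc k)
    then show ?case by (simp add: algebra_simps)
  qed (use assms in auto)
  then show ?thesis ..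
qed

lemma fib_term_Suc_ge:
  fixes r :: real
  assumes "0 \<le> p" "0 < r" "0 < n" "fib (Suc n) \<le> r * fib n"
  shows "r powr (- p) * fib_term p n \<le> fib_term p (Suc n)"
proof -
  have "(r * fib n) powr (- p) \<le> fib (Suc n) powr (- p)"
    using assms fib_pos[of "Suc n"] by (intro powr_mono2') auto
  then show ?thesis using assms by (simp add: fib_term_def powr_mult)
qed

lemma fib_term_Suc_le:
  fixes r :: real
  assumes "0 \<le> p" "0 < r" "0 < n" "r * fib n \<le> fib (Suc n)"
  shows "fib_term p (Suc n) \<le> r powr (- p) * fib_term p n"
proof -
  have "fib (Suc n) powr (- p) \<le> (r * fib n) powr (- p)"
    using assms fib_pos[of n] by (intro powr_mono2') auto
  then show ?thesis using assms by (simp add: fib_term_def powr_mult)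
qed

text \<open>Ratio test: the first two ratios from n = 2 on are 2 and 3/2, so all later ones are at
  least 3/2.\<close>

lemma summable_fib_term:
  assumes "0 < p"
  shows "summable (fib_term p)"
proof (rule summable_ratio_test)
  show "(3/2 :: real) powr (- p) < 1"
    using assms by (simp add: powr_less_one)
  fix n :: nat
  assume "2 \<le> n"
  have "(3/2) * real (fib n) \<le> fib (Suc n)"
    using fib_ratio_ge[of "3/2" 2 "n - 2"] \<open>2 \<le> n\<close> by (simp add: numeral_2_eq_2 Suc_diff_Suc)
  then show "norm (fib_term p (Suc n)) \<le> (3/2) powr (- p) * norm (fib_term p n)"
    using fib_term_Suc_le[of p "3/2" n] assms \<open>2 \<le> n\<close> by (simp add: fib_term_nonneg)
qed

lemma summable_fib_weight_term:
  assumes "0 < p"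
  shows "summable (\<lambda>n. fib_weight n * fib_term p n)"
  by (rule summable_comparison_test'[OF summable_fib_term[OF assms]])
     (auto simp: fib_weight_def fib_term_nonneg)

lemma fib_tail_ge:
  fixes r :: real
  assumes p: "0 < p" and r: "1 < r" and n: "0 < n"
    and "\<And>k. fib (Suc (n + k)) \<le> r * fib (n + k)"
  shows "fib_term p n / (1 - r powr (- p)) \<le> (\<Sum>k. fib_term p (n + k))"
proof -
  have q: "0 \<le> r powr (- p)" "r powr (- p) < 1" using p r by (auto simp: powr_less_one)
  have *: "fib_term p n * (r powr (- p)) ^ k \<le> fib_term p (n + k)" for k
  proof (induction k)
    case (Suc k)
    have "fib_term p n * (r powr (- p)) ^ Suc k \<le> r powr (- p) * fib_term p (n + k)"
      using mult_left_mono[OF Suc.IH q(1)] by (simp add: mult_ac)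
    also have "\<dots> \<le> fib_term p (n + Suc k)"
      using fib_term_Suc_ge[of p r "n + k"] assms by simp
    finally show ?case .
  qed simp
  have "fib_term p n / (1 - r powr (- p)) = (\<Sum>k. fib_term p n * (r powr (- p)) ^ k)"
    using q by (subst suminf_mult) (auto simp: suminf_geometric summable_geometric)
  also have "\<dots> \<le> (\<Sum>k. fib_term p (n + k))"
    using * q summable_fib_term[OF p]
    by (intro suminf_le summable_mult summable_geometric) (auto simp: add.commute[of n])
  finally show ?thesis .
qed

lemma fib_tail_le:
  fixes r :: real
  assumes p: "0 < p" and r: "1 < r" and n: "0 < n"
    and "\<And>k. r * fib (n + k) \<le> fib (Suc (n + k))"
  shows "(\<Sum>k. fib_term p (n + k)) \<le> fib_term p n / (1 - r powr (- p))"
proof -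
  have q: "0 \<le> r powr (- p)" "r powr (- p) < 1" using p r by (auto simp: powr_less_one)
  have *: "fib_term p (n + k) \<le> fib_term p n * (r powr (- p)) ^ k" for k
  proof (induction k)
    case (Suc k)
    have "fib_term p (n + Suc k) \<le> r powr (- p) * fib_term p (n + k)"
      using fib_term_Suc_le[of p r "n + k"] assms by simp
    also have "\<dots> \<le> fib_term p n * (r powr (- p)) ^ Suc k"
      using mult_left_mono[OF Suc.IH q(1)] by (simp add: mult_ac)
    finally show ?case .
  qed simp
  have "(\<Sum>k. fib_term p (n + k)) \<le> (\<Sum>k. fib_term p n * (r powr (- p)) ^ k)"
    using * q summable_fib_term[OF p]
    by (intro suminf_le summable_mult summable_geometric) (auto simp: add.commute[of n])
  also have "\<dots> = fib_term p n / (1 - r powr (- p))"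
    using q by (subst suminf_mult) (auto simp: suminf_geometric summable_geometric)
  finally show ?thesis .
qed

text \<open>\<open>fib_run\<close> does not carry the index and recognises n = 12 by the value 144.
  Monotonicity suffices, as the neighbours are 89 and 233.\<close>

lemma fib_eq_144_iff: "fib n = 144 \<longleftrightarrow> n = 12"
proof -
  have "fib n \<noteq> 144" if "n < 12"
    using fib_mono[of n 11] that by (auto simp: eval_nat_numeral)
  moreover have "fib n \<noteq> 144" if "12 < n"
    using fib_mono[of 13 n] that by (auto simp: eval_nat_numeral)
  moreover have "fib 12 = 144" by (simp add: eval_nat_numeral)
  ultimately show ?thesis by (metis nat_neq_iff)
qed

section \<open>Correctness of the fixed-point summation\<close>

text \<open>The bounds on the partial sum are written out because subtracting the term at 12 need
  not preserve the sign condition of \<open>encl\<close>. The last clause starts at n = 2, since the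
  preceding ratio at n = 1 would divide by \<open>fib 0\<close>.\<close>

definition run_inv :: "real \<Rightarrow> nat \<Rightarrow> int \<times> int \<Rightarrow> int \<times> int \<Rightarrow> int \<times> int \<Rightarrow> int \<times> int \<Rightarrow> bool" where
  "run_inv p n s X R R' \<longleftrightarrow>
     of_int (fst s) \<le> of_int scale * (\<Sum>k<n. fib_weight k * fib_term p k) \<and>
     of_int scale * (\<Sum>k<n. fib_weight k * fib_term p k) \<le> of_int (snd s) \<and>
     encl X (fib_term p n) \<and>
     encl R ((fib (Suc n) / fib n) powr (- p)) \<and>
     (1 < n \<longrightarrow> encl R' ((fib n / fib (n - 1)) powr (- p)))"

text \<open>Write h/g = (g/f) * (f h / g^2). As f h and g^2 differ by 1, the second factor is 1 -
  1/d or its reciprocal, where d is the larger of the two; so the binomial argument 1/d is always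
  positive.\<close>

lemma encl_ratio_step:
  assumes PQ: "0 \<le> P" "P \<le> Q" "0 < Q" and p: "p = real_of_int P / real_of_int Q"
    and fg: "0 < f" "f \<le> g" "f * h < g * g \<Longrightarrow> 2 \<le> g" and h: "h = f + g" 
    and near: "f * h = g * g + 1 \<or> f * h = g * g - 1"
    and R: "encl R ((g / f) powr (- p))"
  shows "encl (if f * h < g * g then imul R (binomial_encl P Q (g * g) 0 m)
               else idiv R (binomial_encl P Q (f * h) 0 m)) ((h / g) powr (- p))"
proof -
  have p01: "0 \<le> p" "p \<le> 1" using PQ by (auto simp: p)
  have real_fg: "0 < real_of_int f" "0 < real_of_int g" "0 < real_of_int h" using fg h by auto
  have bin: "encl (binomial_encl P Q d 0 m) ((1 - 1 / of_int d) powr (- p))" if "2 \<le> d" for d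
    using encl_binomial_encl[OF PQ that, of 0 m] binomial_tail_0[OF p01, of "1 / of_int d"] that
    by (simp add: p)
  show ?thesis
  proof (cases "f * h < g * g")
    case True
    then have eq: "f * h = g * g - 1" using near by linarith
    have gg: "4 \<le> g * g" using fg(3)[OF True] mult_mono[of 2 g 2 g] by simp
    have "1 - 1 / real_of_int (g * g) = of_int f * of_int h / (of_int g * of_int g)"
      using real_fg arg_cong[OF eq, of real_of_int] by (simp add: field_simps)
    moreover have "(g / f) powr (- p) * (of_int f * of_int h / (of_int g * of_int g)) powr (- p) = (h / g) powr (- p)"
      using real_fg by (simp flip: powr_mult)
    ultimately have "(g / f) powr (- p) * (1 - 1 / real_of_int (g * g)) powr (- p) = (h / g) powr (- p)"
      by simp
    then show ?thesis
      using encl_imul[OF R bin[of "g * g"]] gg True by simp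
  next
    case False
    then have eq: "g * g = f * h - 1" using near by linarith
    have "1 - 1 / real_of_int (f * h) = of_int g * of_int g / (of_int f * of_int h)"
      using real_fg arg_cong[OF eq, of real_of_int] by (simp add: field_simps)
    moreover have "(g / f) powr (- p) / (of_int g * of_int g / (of_int f * of_int h)) powr (- p) = (h / g) powr (- p)"
      using real_fg by (simp flip: powr_divide)
    ultimately have "(g / f) powr (- p) / (1 - 1 / real_of_int (f * h)) powr (- p) = (h / g) powr (- p)"
      by simp
    moreover have "2 \<le> f * h"
      using eq fg mult_mono[of 1 g 1 g] by linarith
    ultimately show ?thesis
      using encl_idiv[OF R bin[of "f * h"]] fst_binomial_encl_pos[OF PQ, of "f * h" 0 m] False by simp
  qed
qed

lemma run_inv_step:
  assumes PQ: "0 \<le> P" "P \<le> Q" "0 < Q" and p: "p = real_of_int P / real_of_int Q"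
    and n: "0 < n" and inv: "run_inv p n s X R R'"
    and f: "f = int (fib n)" and g: "g = int (fib (Suc n))" and h: "h = f + g"
  shows "run_inv p (Suc n)
    (if f = 144 then (fst s - snd X, snd s - fst X) else (fst s + fst X, snd s + snd X))
    (imul X R)
    (if f * h < g * g then imul R (binomial_encl P Q (g * g) 0 m)
     else idiv R (binomial_encl P Q (f * h) 0 m)) R"
proof -
  have fg: "0 < f" "f \<le> g"
    using n fib_neq_0_nat[of n] by (auto simp: f g fib_Suc_mono)
  have cassini: "f * h - g * g = - ((- 1) ^ n)"
    using fib_Cassini_int[of n] by (simp add: f g h power2_eq_square algebra_simps)
  then have near: "f * h = g * g + 1 \<or> f * h = g * g - 1"
    by (cases "even n") auto
  \<comment> \<open>This makes d = g^2 at least 2. At n = 1 the product f h = 2 exceeds g^2 = 1, so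
    that index falls into the other case.\<close>
  have g2: "2 \<le> g" if "f * h < g * g"
  proof -
    have "n \<noteq> 1" using that by (auto simp: f g h)
    then have "fib 3 \<le> fib (Suc n)" using n by (intro fib_mono) auto
    then show ?thesis by (simp add: g eval_nat_numeral)
  qed
  have h': "h = int (fib (Suc (Suc n)))" by (simp add: f g h)
  have X: "encl X (fib_term p n)" and R: "encl R ((fib (Suc n) / fib n) powr (- p))"
    using inv by (auto simp: run_inv_def)
  have "encl (imul X R) (fib_term p (Suc n))"
    using encl_imul[OF X R] fib_term_step[OF n] by simp
  moreover have "encl (if f * h < g * g then imul R (binomial_encl P Q (g * g) 0 m)
      else idiv R (binomial_encl P Q (f * h) 0 m)) ((fib (Suc (Suc n)) / fib (Suc n)) powr (- p))"
    using encl_ratio_step[OF PQ p fg g2 h near, of R m] R by (simp add: f g h' del: fib.simps)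
  moreover have "f = 144 \<longleftrightarrow> n = 12"
    using fib_eq_144_iff[of n] unfolding f by linarith
  then have "of_int (fst (if f = 144 then (fst s - snd X, snd s - fst X) else (fst s + fst X, snd s + snd X)))
        \<le> of_int scale * (\<Sum>k<Suc n. fib_weight k * fib_term p k)"
    "of_int scale * (\<Sum>k<Suc n. fib_weight k * fib_term p k)
        \<le> real_of_int (snd (if f = 144 then (fst s - snd X, snd s - fst X) else (fst s + fst X, snd s + snd X)))"
    using inv X by (auto simp: run_inv_def encl_def fib_weight_def algebra_simps)
  ultimately show ?thesis
    using R by (simp only: run_inv_def diff_Suc_1 simp_thms)
qed

lemma run_inv_run:
  assumes PQ: "0 \<le> P" "P \<le> Q" "0 < Q" and p: "p = real_of_int P / real_of_int Q"
  shows "0 < n \<Longrightarrow> run_inv p n s X R R' \<Longrightarrow>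
    fib_run P Q (int (fib n)) (int (fib (Suc n))) s X R R' ms = (s1, X1, R1, R1') \<Longrightarrow>
    run_inv p (n + length ms) s1 X1 R1 R1'"
proof (induction ms arbitrary: n s X R R')
  case (Cons m ms)
  have step: "int (fib n) + int (fib (Suc n)) = int (fib (Suc (Suc n)))" by simp
  show ?case
    using Cons.IH[OF zero_less_Suc run_inv_step[OF PQ p Cons.prems(1,2) refl refl step[symmetric]]
        Cons.prems(3)[unfolded fib_run.simps Let_def step]]
    by simp
qed simp

text \<open>The only summand is the zero term at 0, and F_1 = F_2 = 1 makes term and ratio exactly
  1. The last pair is a placeholder that the first step overwrites.\<close>

lemma run_inv_start: "run_inv p 1 (0, 0) (scale, scale) (scale, scale) (scale, scale)"
  using scale_pos by (simp add: run_inv_def encl_def fib_term_def)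

section \<open>Comparing the weighted sum with 4\<close>

lemma fib_sum_split:
  assumes "0 < p" "12 < n"
  shows "fib_sum p = (\<Sum>k<n. fib_weight k * fib_term p k) + (\<Sum>k. fib_term p (n + k))"
proof -
  have "(\<lambda>k. fib_weight (k + n) * fib_term p (k + n)) = (\<lambda>k. fib_term p (n + k))"
    using assms by (auto simp: fib_weight_def add.commute)
  then show ?thesis
    using suminf_split_initial_segment[OF summable_fib_weight_term[OF assms(1)], of n]
    by (simp add: fib_sum_def)
qed

lemma fib_ratio_gt_1: "1 < n \<Longrightarrow> 1 < real (fib (Suc n)) / real (fib n)"
  using fib_pos[of n] fib_pos[of "n - 1"] by (cases n) auto

text \<open>Two consecutive Fibonacci ratios bracket all later ones, so the rest of the series lies between
  two geometric series.\<close>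

lemma run_inv_above:
  assumes "0 < p" "12 < n" and inv: "run_inv p n s X R R'"
    and above: "4 * scale < fst s + fst X * scale div (scale - min (fst R) (fst R'))"
  shows "4 < fib_sum p"
proof -
  \<comment> \<open>Negative powers reverse the order: the larger ratio r gives the smaller quotient
    q, bounded below by the minimum of the two lower ends.\<close>
  define r where "r = max (real (fib (Suc n)) / fib n) (real (fib n) / fib (n - 1))"
  define q where "q = r powr (- p)"
  define a where "a = min (fst R) (fst R')"
  obtain m where m: "n = Suc m" using assms by (cases n) auto
  have pos: "0 < real (fib n)" "0 < real (fib m)"
    using assms fib_pos by (auto simp: m)
  have r: "1 < r" using fib_ratio_gt_1[of n] assms by (simp add: r_def)
  have q: "q < 1" using r assms by (simp add: q_def powr_less_one)
  have "fib (Suc m) \<le> r * fib m" "fib (Suc (Suc m)) \<le> r * fib (Suc m)"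
    using pos by (auto simp: r_def m pos_divide_le_eq[symmetric] simp del: fib.simps)
  from fib_ratio_le[OF this, of "Suc k" for k]
  have ratio: "fib (Suc (n + k)) \<le> r * fib (n + k)" for k
    by (simp add: m del: fib.simps)
  have tail: "fib_term p n / (1 - q) \<le> (\<Sum>k. fib_term p (n + k))"
    unfolding q_def using assms r ratio by (intro fib_tail_ge) auto
  have "of_int a \<le> of_int scale * q"
    using inv assms(2) by (auto simp: run_inv_def encl_def a_def q_def r_def max_def min_def m simp del: fib.simps)
  then have a: "real_of_int (scale - a) \<ge> of_int scale * (1 - q)" by (simp add: algebra_simps)
  moreover have "of_int scale * (1 - q) > 0" using q scale_pos by simp
  ultimately have sa: "0 < real_of_int (scale - a)" by linarith
  have x: "0 \<le> fst X" "of_int (fst X) \<le> of_int scale * fib_term p n"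
    using inv by (auto simp: run_inv_def encl_def)
  have "of_int (fst X * scale div (scale - a)) \<le> real_of_int (fst X * scale) / of_int (scale - a)"
    by (rule real_of_int_div4)
  also have "\<dots> \<le> (of_int scale * fib_term p n) * of_int scale / (of_int scale * (1 - q))"
    using x a sa q scale_pos by (intro frac_le) (auto simp: mult.commute intro!: mult_mono mult_nonneg_nonneg)
  also have "\<dots> = of_int scale * (fib_term p n / (1 - q))" using scale_pos by simp
  also have "\<dots> \<le> of_int scale * (\<Sum>k. fib_term p (n + k))"
    using tail scale_pos by (intro mult_left_mono) auto
  finally have "of_int (fst s + fst X * scale div (scale - a)) \<le> of_int scale * fib_sum p"
    using inv by (simp add: fib_sum_split[OF assms(1,2)] run_inv_def algebra_simps)
  moreover have "real_of_int (4 * scale) < of_int (fst s + fst X * scale div (scale - a))"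
    using above unfolding a_def of_int_less_iff .
  ultimately have "real_of_int scale * 4 < of_int scale * fib_sum p" by simp
  then show ?thesis using scale_pos by simp
qed

text \<open>Dual to the lower estimate: the smaller ratio gives the larger geometric quotient. Its
  upper end might round up to 1, so positivity of the denominator is assumed instead of
  derived.\<close>

lemma run_inv_below:
  assumes "0 < p" "12 < n" and inv: "run_inv p n s X R R'"
    and r_less: "max (snd R) (snd R') < scale"
    and below: "snd s + snd X * scale div (scale - max (snd R) (snd R')) + 1 < 4 * scale"
  shows "fib_sum p < 4"
proof -
  define r where "r = min (real (fib (Suc n)) / fib n) (real (fib n) / fib (n - 1))"
  define q where "q = r powr (- p)"
  define a where "a = max (snd R) (snd R')"
  obtain m where m: "n = Suc m" using assms by (cases n) auto
  have pos: "0 < real (fib n)" "0 < real (fib m)"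
    using assms fib_pos by (auto simp: m)
  have r: "1 < r" using fib_ratio_gt_1[of n] fib_ratio_gt_1[of m] assms by (simp add: r_def m)
  have q: "q < 1" using r assms by (simp add: q_def powr_less_one)
  have "r * fib m \<le> fib (Suc m)" "r * fib (Suc m) \<le> fib (Suc (Suc m))"
    using pos by (auto simp: r_def m pos_le_divide_eq[symmetric] simp del: fib.simps)
  from fib_ratio_ge[OF this, of "Suc k" for k]
  have ratio: "r * fib (n + k) \<le> fib (Suc (n + k))" for k
    by (simp add: m del: fib.simps)
  have tail: "(\<Sum>k. fib_term p (n + k)) \<le> fib_term p n / (1 - q)"
    unfolding q_def using assms r ratio by (intro fib_tail_le) auto
  have "of_int scale * q \<le> of_int a"
    using inv assms(2) by (auto simp: run_inv_def encl_def a_def q_def r_def max_def min_def m simp del: fib.simps)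
  then have a: "real_of_int (scale - a) \<le> of_int scale * (1 - q)" by (simp add: algebra_simps)
  have sa: "0 < real_of_int (scale - a)" using r_less by (simp add: a_def)
  have x: "0 \<le> fib_term p n" "of_int scale * fib_term p n \<le> of_int (snd X)"
    using inv by (auto simp: run_inv_def encl_def fib_term_nonneg)
  have X: "0 \<le> real_of_int (snd X)"
    using x scale_pos by (smt (verit) mult_nonneg_nonneg of_int_0_less_iff)
  have "of_int scale * (\<Sum>k. fib_term p (n + k)) \<le> of_int scale * (fib_term p n / (1 - q))"
    using tail scale_pos by (intro mult_left_mono) auto
  also have "\<dots> = (of_int scale * fib_term p n) * of_int scale / (of_int scale * (1 - q))"
    using scale_pos by simp
  also have "\<dots> \<le> real_of_int (snd X * scale) / of_int (scale - a)"
    using x X a sa scale_pos by (intro frac_le) (auto simp: mult.commute intro!: mult_mono mult_nonneg_nonneg)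
  also have "\<dots> \<le> of_int (snd X * scale div (scale - a) + 1)"
    by (rule of_int_div_upper)
  finally have "of_int scale * fib_sum p \<le> of_int (snd s + snd X * scale div (scale - a) + 1)"
    using inv by (simp add: fib_sum_split[OF assms(1,2)] run_inv_def algebra_simps)
  moreover have "of_int (snd s + snd X * scale div (scale - a) + 1) < real_of_int (4 * scale)"
    using below unfolding a_def of_int_less_iff .
  ultimately have "of_int scale * fib_sum p < real_of_int scale * 4" by simp
  then show ?thesis using scale_pos by simp
qed

section \<open>Lipschitz continuity and strict monotonicity\<close>

text \<open>With F = F_n the difference is at most F^(-p) (q - p) ln F. Here ln F <= 5 F^(1/5), and
  7/10 - 1/5 = 1/2 leaves a summable power of F.\<close>

lemma fib_term_diff_bounds:
  assumes "7 / 10 \<le> p" "p \<le> q"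
  shows "0 \<le> fib_term p n - fib_term q n" "fib_term p n - fib_term q n \<le> 5 * fib_term (1 / 2) n * (q - p)"
proof -
  have *: "0 \<le> fib_term p n - fib_term q n \<and> fib_term p n - fib_term q n \<le> 5 * fib_term (1 / 2) n * (q - p)"
  proof (cases n)
    case (Suc m)
    define F where "F = real (fib n)"
    have F: "1 \<le> F" using fib_neq_0_nat[of n] Suc by (simp add: F_def)
    have eq: "fib_term p n - fib_term q n = F powr (- p) * (1 - exp (- ((q - p) * ln F)))"
      using F by (simp add: fib_term_def F_def[symmetric] powr_def right_diff_distrib
          flip: exp_add) (simp add: algebra_simps)
    have "1 - exp (- ((q - p) * ln F)) \<le> (q - p) * ln F"
      using exp_ge_add_one_self[of "- ((q - p) * ln F)"] by simp
    also have "ln F \<le> 5 * F powr (1 / 5)"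
      using ln_powr_bound[of F "1 / 5"] F by simp
    finally have le: "1 - exp (- ((q - p) * ln F)) \<le> (q - p) * (5 * F powr (1 / 5))"
      using assms by (simp add: mult_left_mono)
    have nn: "0 \<le> 1 - exp (- ((q - p) * ln F))" using assms F by simp
    have "F powr (- p) * F powr (1 / 5) \<le> F powr (- (1 / 2))"
      unfolding powr_add[symmetric] using assms F by (intro powr_mono) auto
    then have "F powr (- p) * F powr (1 / 5) * (5 * (q - p)) \<le> F powr (- (1 / 2)) * (5 * (q - p))"
      using assms by (intro mult_right_mono) auto
    moreover have "F powr (- p) * (1 - exp (- ((q - p) * ln F))) \<le> F powr (- p) * ((q - p) * (5 * F powr (1 / 5)))"
      using le by (intro mult_left_mono) auto
    moreover have "F powr (- p) * ((q - p) * (5 * F powr (1 / 5))) = F powr (- p) * F powr (1 / 5) * (5 * (q - p))"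
      by (simp only: mult_ac)
    moreover have "F powr (- (1 / 2)) * (5 * (q - p)) = 5 * F powr (- (1 / 2)) * (q - p)"
      by (simp only: mult_ac)
    ultimately have "F powr (- p) * (1 - exp (- ((q - p) * ln F))) \<le> 5 * F powr (- (1 / 2)) * (q - p)"
      by linarith
    moreover have "0 \<le> F powr (- p) * (1 - exp (- ((q - p) * ln F)))"
      using nn by (intro mult_nonneg_nonneg) auto
    ultimately show ?thesis
      unfolding eq by (simp add: fib_term_def F_def[symmetric])
  qed (simp add: fib_term_def)
  then show "0 \<le> fib_term p n - fib_term q n" "fib_term p n - fib_term q n \<le> 5 * fib_term (1 / 2) n * (q - p)"
    by auto
qed

definition fib_lipschitz :: real where
  "fib_lipschitz = (\<Sum>n. 5 * fib_term (1 / 2) n)"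

lemma fib_lipschitz_nonneg: "0 \<le> fib_lipschitz"
  unfolding fib_lipschitz_def
  by (intro suminf_nonneg summable_mult summable_fib_term) (auto simp: fib_term_nonneg)

lemma fib_sum_diff_eq:
  assumes "0 < p" "0 < q"
  shows "fib_sum p - fib_sum q = (\<Sum>n. fib_weight n * (fib_term p n - fib_term q n))"
    and "summable (\<lambda>n. fib_weight n * (fib_term p n - fib_term q n))"
  using suminf_diff[OF summable_fib_weight_term[OF assms(1)] summable_fib_weight_term[OF assms(2)]]
    summable_diff[OF summable_fib_weight_term[OF assms(1)] summable_fib_weight_term[OF assms(2)]]
  by (simp_all add: fib_sum_def right_diff_distrib)

lemma fib_sum_lipschitz:
  assumes "7 / 10 \<le> p" "p \<le> q"
  shows "\<bar>fib_sum p - fib_sum q\<bar> \<le> fib_lipschitz * (q - p)"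
proof -
  have sm: "summable (\<lambda>n. 5 * fib_term (1 / 2) n)"
    by (intro summable_mult summable_fib_term) simp
  have sm': "summable (\<lambda>n. 5 * fib_term (1 / 2) n * (q - p))"
    by (rule summable_mult2[OF sm])
  have le: "norm (fib_weight n * (fib_term p n - fib_term q n)) \<le> 5 * fib_term (1 / 2) n * (q - p)" for n
    using fib_term_diff_bounds[OF assms, of n] by (auto simp: fib_weight_def)
  have "\<bar>fib_sum p - fib_sum q\<bar> \<le> (\<Sum>n. 5 * fib_term (1 / 2) n * (q - p))"
    using norm_suminf_le[OF le sm'] assms fib_sum_diff_eq[of p q] by simp
  also have "\<dots> = fib_lipschitz * (q - p)"
    unfolding fib_lipschitz_def by (rule suminf_mult2[OF sm, symmetric])
  finally show ?thesis .
qed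

lemma fib_3_4_12: "fib 3 = 2" "fib 4 = 3" "fib 12 = 144"
  by (simp_all add: eval_nat_numeral)

text \<open>Only n = 12 has a negative weight, and the drop of 2^(-p) outweighs that of 144^(-p):
  with e = q - p, 144 <= 2^8 and Bernoulli give 1 - 144^(-e) <= 8 (1 - 2^(-e)), while 72^p > 8,
  which follows from 8^10 < 72^7.\<close>

lemma fib_sum_strict_antimono:
  assumes "7 / 10 \<le> p" "p < q"
  shows "fib_sum q < fib_sum p"
proof -
  define y where "y = (2::real) powr (- (q - p))"
  have y: "0 < y" "y < 1" using assms by (auto simp: y_def powr_less_one)
  have d3: "fib_term p 3 - fib_term q 3 = 2 powr (- p) * (1 - y)"
    using assms by (simp add: fib_term_def fib_3_4_12 y_def right_diff_distrib flip: powr_add)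
  have "y ^ 8 = (2 powr 8) powr (- (q - p))"
    by (simp only: y_def powr_powr powr_realpow[symmetric] powr_gt_zero zero_less_numeral)
       (simp add: powr_powr powr_power mult.commute)
  also have "(2::real) powr 8 = 256" by simp
  also have "(256::real) powr (- (q - p)) \<le> 144 powr (- (q - p))"
    using assms by (intro powr_mono2') auto
  finally have "1 - 144 powr (- (q - p)) \<le> 1 - y ^ 8" by simp
  also have "\<dots> \<le> 8 * (1 - y)"
    using Bernoulli_inequality[of "y - 1" 8] y by simp
  finally have y8: "1 - 144 powr (- (q - p)) \<le> 8 * (1 - y)" .
  have "(8::real) ^ 10 < (72 powr (7 / 10)) ^ 10"
    by (simp add: powr_power)
  then have "(8::real) < 72 powr (7 / 10)" by (rule power_less_imp_less_base) simp
  also have "\<dots> \<le> 72 powr p" using assms by (intro powr_mono) auto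
  finally have "144 powr (- p) * 8 < (144::real) powr (- p) * 72 powr p" by simp
  also have "\<dots> = (144 / 72) powr (- p)"
    by (subst powr_divide) (auto simp: powr_minus divide_inverse)
  finally have p8: "144 powr (- p) * 8 < (2::real) powr (- p)" by simp
  have "fib_term p 12 - fib_term q 12 = 144 powr (- p) * (1 - 144 powr (- (q - p)))"
    using assms by (simp add: fib_term_def fib_3_4_12 right_diff_distrib flip: powr_add)
  also have "\<dots> \<le> 144 powr (- p) * (8 * (1 - y))"
    using y8 by (intro mult_left_mono) auto
  also have "\<dots> < 2 powr (- p) * (1 - y)"
    using mult_strict_right_mono[OF p8, of "1 - y"] y by (simp only: mult.assoc)
  finally have d12: "fib_term p 12 - fib_term q 12 < fib_term p 3 - fib_term q 3"
    by (simp only: d3)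
  have "0 < (\<Sum>n\<in>{3, 12}. fib_weight n * (fib_term p n - fib_term q n))"
    using d12 by (simp add: fib_weight_def)
  also have "\<dots> \<le> (\<Sum>n. fib_weight n * (fib_term p n - fib_term q n))"
    using assms fib_term_diff_bounds(1)[of p q]
    by (intro sum_le_suminf fib_sum_diff_eq) (auto simp: fib_weight_def)
  also have "\<dots> = fib_sum p - fib_sum q"
    using fib_sum_diff_eq[of p q] assms by simp
  finally show ?thesis by simp
qed

section \<open>Phases and the Dirichlet series\<close>

lemma phase_eq_cis: "0 < m \<Longrightarrow> phase m z = cis (- (Im z * ln m))"
  by (simp add: phase_def powr_def cis_conv_exp mult_ac)

lemma norm_phase: "0 < m \<Longrightarrow> norm (phase m z) = 1"
  by (simp add: phase_eq_cis)

lemma phase_mult: "0 < m \<Longrightarrow> 0 < n \<Longrightarrow> phase (m * n) z = phase m z * phase n z"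
  by (simp add: phase_eq_cis ln_mult cis_mult algebra_simps)

lemma fib_powr_eq:
  "of_nat (fib n) powr (- s) = of_real (fib_term (Re s) n) * phase (fib n) s"
proof (cases "n = 0")
  case False
  have "of_nat (fib n) powr of_real (- Re s) = complex_of_real (fib_term (Re s) n)"
    using powr_of_real[of "real (fib n)" "- Re s"] by (simp add: fib_term_def del: of_real_minus)
  moreover have "- s = of_real (- Re s) + - (\<i> * of_real (Im s))"
    by (simp add: complex_eq_iff)
  ultimately show ?thesis
    by (simp only: phase_def powr_add)
qed (simp add: fib_term_def)

text \<open>The vanishing term at 0 undoes the index shift in \<open>Z_F\<close>; absolute
  convergence comes from phases of modulus 1.\<close>

lemma Z_F_sums:
  assumes "0 < Re s"
  shows "(\<lambda>n. of_real (fib_term (Re s) n) * phase (fib n) s) sums Z_F s"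
proof -
  let ?f = "\<lambda>n. of_real (fib_term (Re s) n) * phase (fib n) s"
  have "summable ?f"
  proof (rule summable_comparison_test'[OF summable_fib_term[OF assms]])
    show "norm (?f n) \<le> fib_term (Re s) n" for n
      using norm_phase[of "fib n" s] fib_neq_0_nat[of n]
      by (cases "n = 0") (auto simp: norm_mult fib_term_nonneg fib_term_def)
  qed
  moreover have "Z_F s = (\<Sum>n. ?f (Suc n))"
    by (simp add: Z_F_def fib_powr_eq del: fib.simps)
  ultimately have "summable ?f" "Z_F s = suminf ?f"
    using suminf_split_head[of ?f] by (simp_all add: fib_term_def del: fib.simps(3))
  then show ?thesis by (simp add: sums_iff)
qed

text \<open>The sign change at n = 12 accounts for the summand 2 * 144^(-x) in the equation defining
  \<open>sigma_F\<close>.\<close>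

lemma suminf_fib_term:
  assumes "0 < p"
  shows "(\<Sum>n. fib_term p n) = fib_sum p + 2 * fib_term p 12"
proof -
  have "(\<lambda>n. fib_weight n * fib_term p n + (if n = 12 then 2 * fib_term p 12 else 0)) sums
      (fib_sum p + 2 * fib_term p 12)"
    using summable_fib_weight_term[OF assms] sums_single[of 12 "\<lambda>_. 2 * fib_term p 12"]
    by (intro sums_add) (auto simp: fib_sum_def)
  also have "(\<lambda>n. fib_weight n * fib_term p n + (if n = 12 then 2 * fib_term p 12 else 0)) = fib_term p"
    by (auto simp: fib_weight_def)
  finally show ?thesis by (simp add: sums_iff)
qed

lemma Z_F_of_real:
  assumes "0 < p"
  shows "Z_F (of_real p) = of_real (fib_sum p + 2 * 144 powr (- p))"
proof -
  have "(\<lambda>n. of_real (fib_term p n) * phase (fib n) (of_real p)) = (\<lambda>n. complex_of_real (fib_term p n))"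
  proof
    show "of_real (fib_term p n) * phase (fib n) (of_real p) = complex_of_real (fib_term p n)" for n
      using phase_eq_cis[of "fib n" "of_real p"] fib_neq_0_nat[of n]
      by (cases "n = 0") (auto simp: fib_term_def)
  qed
  moreover have "(\<lambda>n. complex_of_real (fib_term p n)) sums of_real (fib_sum p + 2 * fib_term p 12)"
    using summable_fib_term[OF assms] suminf_fib_term[OF assms] by (intro sums_of_real) (simp add: sums_iff)
  ultimately show ?thesis
    using Z_F_sums[of "of_real p"] assms by (simp add: sums_iff fib_term_def fib_3_4_12)
qed

text \<open>The defining equation reads \<open>fib_sum x = 4\<close>. The intermediate value theorem
  gives a solution and strict monotonicity makes it unique, so the definite description denotes
  it.\<close>

lemma sigma_F_between:
  assumes "7 / 10 < a" "a < b" "b < 3 / 4" "4 < fib_sum a" "fib_sum b < 4"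
  shows "a < sigma_F \<and> sigma_F < b \<and> fib_sum sigma_F = 4"
proof -
  have "fib_lipschitz-lipschitz_on {a..b} fib_sum"
  proof (rule lipschitz_onI)
    show "dist (fib_sum x) (fib_sum y) \<le> fib_lipschitz * dist x y" if "x \<in> {a..b}" "y \<in> {a..b}" for x y
      using that assms fib_sum_lipschitz[of x y] fib_sum_lipschitz[of y x]
      by (cases "x \<le> y") (auto simp: dist_real_def abs_minus_commute)
  qed (rule fib_lipschitz_nonneg)
  then have cont: "continuous_on {a..b} fib_sum" by (rule lipschitz_on_continuous_on)
  obtain x where x: "a \<le> x" "x \<le> b" "fib_sum x = 4"
    using IVT2'[of fib_sum b 4 a, OF _ _ _ cont] assms by auto
  have eq: "Z_F (of_real y) = 4 + 2 * of_real (144 powr (- y)) \<longleftrightarrow> fib_sum y = 4" if "0.7 < y" for y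
  proof -
    have "Z_F (of_real y) = 4 + 2 * of_real (144 powr (- y)) \<longleftrightarrow>
        complex_of_real (fib_sum y + 2 * 144 powr (- y)) = of_real (4 + 2 * 144 powr (- y))"
      using that by (subst Z_F_of_real) auto
    then show ?thesis by (simp only: of_real_eq_iff) simp
  qed
  have "sigma_F = x"
    unfolding sigma_F_def
  proof (rule the_equality)
    show "0.7 < x \<and> x < 0.75 \<and> Z_F (of_real x) = 4 + 2 * of_real (144 powr (- x))"
      using x assms eq[of x] by auto
    show "y = x" if "0.7 < y \<and> y < 0.75 \<and> Z_F (of_real y) = 4 + 2 * of_real (144 powr (- y))" for y
      using that x assms eq[of y] fib_sum_strict_antimono[of x y] fib_sum_strict_antimono[of y x]
      by (cases x y rule: linorder_cases) auto
  qed
  moreover have "x \<noteq> a" "x \<noteq> b" using x assms by auto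
  ultimately show ?thesis using x by auto
qed

subsection \<open>Numerical enclosure of \<open>\<sigma>\<^sub>F\<close>\<close>

definition fib_run_above :: "int \<Rightarrow> int \<Rightarrow> bool" where
  "fib_run_above P Q \<longleftrightarrow>
    (let (s, X, R, R') = fib_run P Q 1 1 (0, 0) (scale, scale) (scale, scale) (scale, scale) series_lengths
     in 4 * scale < fst s + fst X * scale div (scale - min (fst R) (fst R')))"

definition fib_run_below :: "int \<Rightarrow> int \<Rightarrow> bool" where
  "fib_run_below P Q \<longleftrightarrow>
    (let (s, X, R, R') = fib_run P Q 1 1 (0, 0) (scale, scale) (scale, scale) (scale, scale) series_lengths;
         r = max (snd R) (snd R')
     in r < scale \<and> snd s + snd X * scale div (scale - r) + 1 < 4 * scale)"

lemma run_inv_series_lengths: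
  assumes "0 < P" "P \<le> Q"
    and run: "fib_run P Q 1 1 (0, 0) (scale, scale) (scale, scale) (scale, scale) series_lengths = (s, X, R, R')"
  shows "run_inv (P / Q) (1 + length series_lengths) s X R R'"
proof (rule run_inv_run[OF _ _ _ refl zero_less_one run_inv_start])
  show "fib_run P Q (int (fib 1)) (int (fib (Suc 1))) (0, 0) (scale, scale) (scale, scale) (scale, scale)
      series_lengths = (s, X, R, R')"
    using run by (simp only: fib_1 fib_2 Suc_1 of_nat_1)
qed (use assms in auto)

lemma length_series_lengths: "12 < 1 + length series_lengths"
  by (simp add: series_lengths_def)

lemma fib_run_aboveD:
  assumes "fib_run_above P Q" "0 < P" "P \<le> Q"
  shows "4 < fib_sum (P / Q)"
proof -
  obtain s X R R' where run: "fib_run P Q 1 1 (0, 0) (scale, scale) (scale, scale) (scale, scale) series_lengths = (s, X, R, R')"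
    by (rule prod_cases4)
  show ?thesis
    using assms(1) unfolding fib_run_above_def run Let_def prod.case
    using assms(2,3) by (intro run_inv_above[OF _ length_series_lengths run_inv_series_lengths[OF assms(2,3) run]]) auto
qed

lemma fib_run_belowD:
  assumes "fib_run_below P Q" "0 < P" "P \<le> Q"
  shows "fib_sum (P / Q) < 4"
proof -
  obtain s X R R' where run: "fib_run P Q 1 1 (0, 0) (scale, scale) (scale, scale) (scale, scale) series_lengths = (s, X, R, R')"
    by (rule prod_cases4)
  show ?thesis
    using assms(1) unfolding fib_run_below_def run Let_def prod.case
    using assms(2,3) by (intro run_inv_below[OF _ length_series_lengths run_inv_series_lengths[OF assms(2,3) run]]) auto
qed

text \<open>The endpoints here and in the next certificate are 1.4e-11 apart. This moves
  \<open>1 / (sigma_F * ln phi)\<close> by about 5e-11, less than the 1e-10 between its claimed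
  decimal bounds.\<close>

lemma fib_run_above_cert: "fib_run_above 743163398726 (10 ^ 12)"
  by code_simp

lemma fib_run_below_cert: "fib_run_below 74316339874 (10 ^ 11)"
  by code_simp

lemma sigma_F_enclosure:
  "743163398726 / 10 ^ 12 < sigma_F" "sigma_F < 74316339874 / 10 ^ 11" "fib_sum sigma_F = 4"
proof -
  have "4 < fib_sum (743163398726 / 10 ^ 12)"
    using fib_run_aboveD[OF fib_run_above_cert] by simp
  moreover have "fib_sum (74316339874 / 10 ^ 11) < 4"
    using fib_run_belowD[OF fib_run_below_cert] by simp
  ultimately show "743163398726 / 10 ^ 12 < sigma_F" "sigma_F < 74316339874 / 10 ^ 11" "fib_sum sigma_F = 4"
    using sigma_F_between[of "743163398726 / 10 ^ 12" "74316339874 / 10 ^ 11"] by auto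
qed

text \<open>From phi^2 = phi + 1 one gets (phi^2 - 1) / (phi^2 + 1) = 1 / sqrt 5, so ln (phi^2) = 2
  artanh (1 / sqrt 5) is a series in powers of 1/5. After 18 terms the remainder is below
  1e-14.\<close>

lemma ln_phi_bounds: "0.4812118250595 \<le> ln phi" "ln phi \<le> 0.4812118250597"
proof -
  have sq: "2.236067977499789 \<le> sqrt 5" "sqrt 5 \<le> 2.236067977499790"
    by (rule real_le_rsqrt real_le_lsqrt; simp add: power2_eq_square)+
  have "phi \<noteq> 0" "phi\<^sup>2 - 1 = phi" "phi\<^sup>2 + 1 = sqrt 5 * phi"
    using sq by (simp_all add: phi_def field_simps power2_eq_square)
  then have y: "(phi\<^sup>2 - 1) / (phi\<^sup>2 + 1) = sqrt 5 / 5"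
    by (simp add: field_simps)
  have phi: "1 < phi" using sq by (simp add: phi_def)
  then have "1 < phi\<^sup>2" by simp
  note bounds = ln_approx_bounds[OF this, of 18]
  have pow: "(sqrt 5 / 5) ^ (2 * k + 1) = sqrt 5 / 5 * (1 / 5) ^ k" for k
    by (simp add: power_mult power_divide power2_eq_square)
  have pow2: "(sqrt 5 / 5)\<^sup>2 = 1 / 5" by (simp add: power_divide)
  have ln2: "ln (phi\<^sup>2) = 2 * ln phi" using phi by (simp add: ln_realpow)
  \<comment> \<open>With sqrt 5 factored out, the sum is rational and can be evaluated
    exactly.\<close>
  have sum: "(\<Sum>k<18. 2 * (sqrt 5 / 5 * (1 / 5) ^ k) / real (2 * k + 1)) =
      sqrt 5 * (\<Sum>k<18. 2 / 5 * (1 / 5) ^ k / real (2 * k + 1))"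
    unfolding sum_distrib_left by (intro sum.cong) simp_all
  have *: "2 * ln phi \<in> {sqrt 5 * (\<Sum>k<18. 2 / 5 * (1 / 5) ^ k / real (2 * k + 1))..
     sqrt 5 * (\<Sum>k<18. 2 / 5 * (1 / 5) ^ k / real (2 * k + 1)) +
       2 * (sqrt 5 / 5 * (1 / 5) ^ 18 / (1 - 1 / 5) / real (2 * 18 + 1))}"
    using bounds unfolding y pow pow2 ln2 sum .
  have S: "0.430408940964000 \<le> (\<Sum>k<18. 2 / 5 * (1 / 5) ^ k / real (2 * k + 1))"
    "(\<Sum>k<18. 2 / 5 * (1 / 5) ^ k / real (2 * k + 1)) \<le> (0.430408940964001 :: real)"
    by (simp_all add: lessThan_nat_numeral power_divide)
  have "2.236067977499789 * 0.430408940964000 \<le> sqrt 5 * (\<Sum>k<18. 2 / 5 * (1 / 5) ^ k / real (2 * k + 1))"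
    using sq S by (intro mult_mono) auto
  moreover have "sqrt 5 * (\<Sum>k<18. 2 / 5 * (1 / 5) ^ k / real (2 * k + 1)) \<le> 2.236067977499790 * 0.430408940964001"
    using sq S by (intro mult_mono sum_nonneg) auto
  ultimately show "0.4812118250595 \<le> ln phi" "ln phi \<le> 0.4812118250597"
    using * sq by (simp_all add: power_divide)
qed

lemma exponent_bounds:
  "2.7962718895 \<le> 1 / (sigma_F * ln phi)" "1 / (sigma_F * ln phi) < 2.7962718896"
proof -
  have lo: "743163398726 / 10 ^ 12 * 0.4812118250595 \<le> sigma_F * ln phi"
    using sigma_F_enclosure ln_phi_bounds by (intro mult_mono) auto
  have hi: "sigma_F * ln phi \<le> 74316339874 / 10 ^ 11 * 0.4812118250597"
    using sigma_F_enclosure ln_phi_bounds by (intro mult_mono) auto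
  have pos: "0 < sigma_F * ln phi" using lo by (simp add: field_simps)
  show "2.7962718895 \<le> 1 / (sigma_F * ln phi)"
    using hi by (simp add: pos_le_divide_eq[OF pos])
  show "1 / (sigma_F * ln phi) < 2.7962718896"
    using lo by (simp add: pos_divide_less_eq[OF pos])
qed

subsection \<open>Phases at zeros\<close>

lemma norm_phase_plus_1: "0 < m \<Longrightarrow> (norm (phase m z + 1))\<^sup>2 = 2 * (1 + Re (phase m z))"
  unfolding cmod_power2 phase_eq_cis
  using sin_cos_squared_add[of "Im z * ln m"] by (simp add: power2_eq_square algebra_simps)

lemma phase_fib_plus_1_nonneg: "0 < n \<Longrightarrow> 0 \<le> 1 + Re (phase (fib n) z)"
  using abs_Re_le_cmod[of "phase (fib n) z"] norm_phase[of "fib n" z] fib_neq_0_nat[of n] by simp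

lemma phase_144: "phase 144 z = phase 2 z ^ 4 * phase 3 z ^ 2"
proof -
  have "(144::nat) = 2 * (2 * (2 * (2 * (3 * 3))))" by simp
  then show ?thesis
    by (simp only: phase_mult zero_less_mult_iff zero_less_numeral simp_thms) (simp add: eval_nat_numeral)
qed

lemma phase_8: "phase 8 z = phase 2 z ^ 3"
proof -
  have "(8::nat) = 2 * (2 * 2)" by simp
  then show ?thesis
    by (simp only: phase_mult zero_less_mult_iff zero_less_numeral simp_thms) (simp add: eval_nat_numeral)
qed

text \<open>Split into z^4 (w^2 - 1) and z^4 - 1 and factor out w + 1 and z + 1; the cofactors are
  bounded by 2 and by 2 * 2.\<close>

lemma norm_monomial_minus_1_le:
  fixes z w :: complex
  assumes "norm z = 1" "norm w = 1"
  shows "norm (z ^ 4 * w ^ 2 - 1) \<le> 4 * norm (z + 1) + 2 * norm (w + 1)"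
proof -
  have "z ^ 4 * w ^ 2 - 1 = z ^ 4 * ((w - 1) * (w + 1)) + (z - 1) * (z ^ 2 + 1) * (z + 1)"
    by (simp add: eval_nat_numeral algebra_simps)
  also have "norm \<dots> \<le> norm (z ^ 4 * ((w - 1) * (w + 1))) + norm ((z - 1) * (z ^ 2 + 1) * (z + 1))"
    by (rule norm_triangle_ineq)
  also have "norm (z ^ 4 * ((w - 1) * (w + 1))) \<le> 2 * norm (w + 1)"
    using assms norm_triangle_ineq4[of w 1] by (simp add: norm_mult norm_power mult_right_mono)
  also have "norm ((z - 1) * (z ^ 2 + 1) * (z + 1)) \<le> (2 * 2) * norm (z + 1)"
    unfolding norm_mult using assms norm_triangle_ineq4[of z 1] norm_triangle_ineq[of "z ^ 2" 1]
    by (intro mult_right_mono mult_mono) (auto simp: norm_power)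
  finally show ?thesis by simp
qed

text \<open>At abscissae close to \<open>\<sigma>\<^sub>F\<close> the deviation of \<open>144\<^sup>-\<^sup>i\<^sup>t = (2\<^sup>-\<^sup>i\<^sup>t)\<^sup>4 (3\<^sup>-\<^sup>i\<^sup>t)\<^sup>2\<close> from \<open>1\<close>, the only
  contribution of the wrong sign, is absorbed by the terms of \<open>2\<close> and \<open>3\<close>.\<close>

lemma term_144_absorbed:
  assumes p: "37 / 50 \<le> p"
  shows "fib_term p 12 * (1 - Re (phase (fib 12) z)) \<le>
    19 / 20 * (fib_term p 3 * (1 + Re (phase (fib 3) z)) + fib_term p 4 * (1 + Re (phase (fib 4) z)))"
proof -
  define A B where "A = norm (phase 2 z + 1)" and "B = norm (phase 3 z + 1)"
  have A2: "A\<^sup>2 = 2 * (1 + Re (phase 2 z))" and B2: "B\<^sup>2 = 2 * (1 + Re (phase 3 z))"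
    by (simp_all add: A_def B_def norm_phase_plus_1)
  have "2 * (1 - Re (phase 144 z)) = (norm (phase 144 z - 1))\<^sup>2"
    unfolding cmod_power2 using norm_phase[of 144 z] cmod_power2[of "phase 144 z"]
    by (simp add: power2_eq_square algebra_simps)
  also have "\<dots> \<le> (4 * A + 2 * B)\<^sup>2"
    unfolding phase_144 A_def B_def
    by (intro power_mono norm_monomial_minus_1_le) (auto simp: norm_phase)
  \<comment> \<open>A weighted Cauchy-Schwarz inequality as an identity. The weights keep 64/3 below
    23 and 16 below 17, the bounds for 72^p and 48^p that follow.\<close>
  also have "\<dots> = 4 / 3 * 16 * A\<^sup>2 + 16 * B\<^sup>2 - 4 / 3 * (2 * A - 3 * B)\<^sup>2"
    by (simp add: power2_eq_square algebra_simps)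
  also have "\<dots> \<le> 64 / 3 * A\<^sup>2 + 16 * B\<^sup>2" by simp
  finally have le: "2 * (1 - Re (phase 144 z)) \<le> 64 / 3 * A\<^sup>2 + 16 * B\<^sup>2" .
  \<comment> \<open>Taking 50th powers reduces these to 23^50 <= 72^37 and 17^50 <= 48^37.\<close>
  have "(23::real) \<le> 72 powr (37 / 50)" "(17::real) \<le> 48 powr (37 / 50)"
    by (rule power_le_imp_le_base[of _ 49]; simp add: powr_power)+
  moreover have "(72::real) powr (37 / 50) \<le> 72 powr p" "(48::real) powr (37 / 50) \<le> 48 powr p"
    using p by (auto intro!: powr_mono)
  ultimately have "23 \<le> (72::real) powr p" "17 \<le> (48::real) powr p" by linarith+
  then have "144 powr (- p) * 23 \<le> (144::real) powr (- p) * 72 powr p"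
    "144 powr (- p) * 17 \<le> (144::real) powr (- p) * 48 powr p"
    by (auto intro: mult_left_mono)
  moreover have "(144::real) powr (- p) * 72 powr p = 2 powr (- p)"
    using powr_mult[of 2 72 "- p"] by (simp add: powr_minus)
  moreover have "(144::real) powr (- p) * 48 powr p = 3 powr (- p)"
    using powr_mult[of 3 48 "- p"] by (simp add: powr_minus)
  ultimately have "144 powr (- p) * 23 \<le> (2::real) powr (- p)" "144 powr (- p) * 17 \<le> (3::real) powr (- p)"
    by simp_all
  then have "144 powr (- p) * 23 * A\<^sup>2 \<le> 2 powr (- p) * A\<^sup>2" "144 powr (- p) * 17 * B\<^sup>2 \<le> 3 powr (- p) * B\<^sup>2"
    by (auto intro: mult_right_mono)
  then have "23 * (144 powr (- p) * A\<^sup>2) \<le> 2 powr (- p) * A\<^sup>2" "17 * (144 powr (- p) * B\<^sup>2) \<le> 3 powr (- p) * B\<^sup>2"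
    by (simp_all only: mult_ac)
  moreover have "144 powr (- p) * (2 * (1 - Re (phase 144 z))) \<le> 64 / 3 * (144 powr (- p) * A\<^sup>2) + 16 * (144 powr (- p) * B\<^sup>2)"
    using mult_left_mono[OF le, of "144 powr (- p)"] by (simp add: distrib_left mult_ac)
  moreover have "0 \<le> 144 powr (- p) * A\<^sup>2" "0 \<le> 144 powr (- p) * B\<^sup>2" by auto
  \<comment> \<open>Both (64/3) / 23 and 16 / 17 are below 19/20.\<close>
  moreover have key: "u \<le> 19 / 20 * (c + d)"
    if "23 * a \<le> c" "17 * b \<le> d" "u \<le> 64 / 3 * a + 16 * b" "0 \<le> a" "0 \<le> b" for a b c d u :: real
    using that by argo
  ultimately have "144 powr (- p) * (2 * (1 - Re (phase 144 z))) \<le> 19 / 20 * (2 powr (- p) * A\<^sup>2 + 3 powr (- p) * B\<^sup>2)"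
    by (intro key)
  then show ?thesis
    by (simp add: fib_term_def fib_3_4_12 A2 B2 algebra_simps)
qed

text \<open>Adding the vanishing real part of \<open>Z_F s\<close> to the sum of moduli gives a
  series of nonnegative h k, in which n = 1 and n = 2 contribute exactly 4. Absorbing n = 12 leaves
  1/20 of the terms at 3 and 4 and all of any other term, hence the factor 20.\<close>

lemma zero_phase_bound:
  assumes Z: "Z_F s = 0" and p: "37 / 50 \<le> Re s" and n: "3 \<le> n" "n \<noteq> 12"
  shows "fib_term (Re s) n * (1 + Re (phase (fib n) s)) \<le> 20 * (fib_sum (Re s) - 4)"
proof -
  define p where "p = Re s"
  define h where "h = (\<lambda>n. fib_term p n * (1 + Re (phase (fib n) s)))"
  have h_nonneg: "0 \<le> h k" for k
    using phase_fib_plus_1_nonneg[of k s] fib_term_nonneg[of p k]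
    by (cases "k = 0") (auto simp: h_def fib_term_def)
  have p0: "0 < p" using p by (simp add: p_def)
  have "(\<lambda>k. Re (of_real (fib_term p k) * phase (fib k) s)) sums Re 0"
    using Z_F_sums[of s] p0 Z by (intro sums_Re) (simp add: p_def)
  then have cos_sums: "(\<lambda>k. fib_term p k * Re (phase (fib k) s)) sums 0" by simp
  have "fib_term p sums (fib_sum p + 2 * fib_term p 12)"
    using summable_fib_term[OF p0] suminf_fib_term[OF p0] by (simp add: sums_iff)
  from sums_add[OF this cos_sums] have h: "h sums (fib_sum p + 2 * fib_term p 12)"
    by (simp add: h_def distrib_left)
  have h_1_2: "h 1 = 2" "h 2 = 2"
    by (simp_all add: h_def fib_term_def phase_eq_cis)
  have absorbed: "2 * fib_term p 12 - h 12 \<le> 19 / 20 * (h 3 + h 4)"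
    using term_144_absorbed[of p s] p by (simp add: h_def p_def algebra_simps)
  have "sum h (insert n {1, 2, 3, 4, 12}) \<le> suminf h"
    using h h_nonneg by (intro sum_le_suminf) (auto dest: sums_summable)
  then have "sum h (insert n {1, 2, 3, 4, 12}) \<le> fib_sum p + 2 * fib_term p 12"
    using sums_unique[OF h] by linarith
  \<comment> \<open>The value 0 avoids counting h n twice when n is 3 or 4.\<close>
  moreover define t where "t = (if n = 3 \<or> n = 4 then 0 else h n)"
  have "sum h {1, 2, 3, 4, 12} = 4 + h 3 + h 4 + h 12"
    using h_1_2 by simp
  then have "sum h (insert n {1, 2, 3, 4, 12}) = 4 + h 3 + h 4 + h 12 + t"
    unfolding t_def
    using n by (subst sum.insert_if) (simp_all only: insert_iff empty_iff finite.intros, auto)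
  ultimately have "4 + h 3 + h 4 + h 12 + t \<le> fib_sum p + 2 * fib_term p 12" by simp
  then have "1 / 20 * (h 3 + h 4) + t \<le> fib_sum p - 4"
    using absorbed by argo
  moreover have "h n = t \<or> h n = h 3 \<and> t = 0 \<or> h n = h 4 \<and> t = 0" "0 \<le> t"
    using h_nonneg[of n] by (auto simp: t_def)
  ultimately have "h n \<le> 20 * (fib_sum p - 4)"
    using h_nonneg[of 3] h_nonneg[of 4] by argo
  then show ?thesis by (simp add: h_def p_def)
qed

lemma sigma_F_gt: "37 / 50 < sigma_F"
  using sigma_F_enclosure(1) by simp

lemma phi_pos: "1 < phi" and phi_sq: "phi\<^sup>2 = phi + 1"
proof -
  have "1 < sqrt 5" by simp
  then show "1 < phi" by (simp add: phi_def)
  show "phi\<^sup>2 = phi + 1" by (simp add: phi_def power2_eq_square field_simps)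
qed

lemma fib_le_phi_power: "real (fib n) \<le> phi ^ n"
proof (induction n rule: fib.induct)
  case (3 n)
  have "phi ^ Suc (Suc n) = phi ^ n * phi\<^sup>2" by (simp add: power2_eq_square)
  also have "\<dots> = phi ^ Suc n + phi ^ n" by (simp add: phi_sq distrib_left)
  finally show ?case using 3 by simp
qed (use phi_pos in auto)

lemma le_fib_Suc: "n \<le> fib (Suc n)"
proof (induction n rule: fib.induct)
  case (3 n)
  then show ?case using fib_neq_0_nat[of "Suc n"] by simp
qed auto

text \<open>The factor 40 is 20 from \<open>zero_phase_bound\<close> times 2 from
  \<open>norm_phase_plus_1\<close>.\<close>

definition phase_const :: real where
  "phase_const = 40 * fib_lipschitz"

text \<open>Since \<open>fib_sum sigma_F = 4\<close>, the Lipschitz bound turns the excess over 4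
  into a multiple of \<open>eps s\<close>; then divide by the term and raise its exponent to
  \<open>sigma_F\<close>.\<close>

lemma norm_phase_fib_sq_le:
  assumes "Z_F s = 0" "37 / 50 \<le> Re s" "Re s \<le> sigma_F" "3 \<le> n" "n \<noteq> 12"
  shows "(norm (phase (fib n) s + 1))\<^sup>2 \<le> phase_const * real (fib n) powr sigma_F * eps s"
proof -
  have F: "1 \<le> real (fib n)" using fib_neq_0_nat[of n] assms by simp
  have "fib_sum (Re s) - 4 \<le> fib_lipschitz * eps s"
    using fib_sum_lipschitz[of "Re s" sigma_F] assms sigma_F_enclosure(3) by (simp add: eps_def)
  then have "fib_term (Re s) n * (1 + Re (phase (fib n) s)) \<le> 20 * (fib_lipschitz * eps s)"
    using zero_phase_bound[of s n] assms by simp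
  then have "real (fib n) powr Re s * (fib_term (Re s) n * (1 + Re (phase (fib n) s)))
      \<le> real (fib n) powr Re s * (20 * (fib_lipschitz * eps s))"
    by (intro mult_left_mono) auto
  moreover have "real (fib n) powr Re s * fib_term (Re s) n = 1"
    using F by (simp add: fib_term_def flip: powr_add)
  ultimately have "1 + Re (phase (fib n) s) \<le> real (fib n) powr Re s * (20 * (fib_lipschitz * eps s))"
    by (simp flip: mult.assoc)
  also have "\<dots> \<le> real (fib n) powr sigma_F * (20 * (fib_lipschitz * eps s))"
    using F assms fib_lipschitz_nonneg by (intro mult_right_mono powr_mono) (auto simp: eps_def)
  finally show ?thesis
    using norm_phase_plus_1[of "fib n" s] F by (simp add: phase_const_def algebra_simps)
qed

section \<open>No zeros on the boundary line\<close>

text \<open>Here \<open>eps s = 0\<close> forces the phases to be exactly -1. Then F_n F_(n+2) and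
  F_(n+1)^2, which differ by 1, both have phase 1, so t = Im s times the small difference d of their
  logarithms is a multiple of 2 pi. For large n this means t = 0, but then the phase of 2 is
  1.\<close>

lemma Z_F_nonzero_on_line:
  assumes "Re s = sigma_F"
  shows "Z_F s \<noteq> 0"
proof
  assume Z: "Z_F s = 0"
  have ph: "phase (fib n) s = - 1" if "3 \<le> n" "n \<noteq> 12" for n
  proof -
    have "(norm (phase (fib n) s + 1))\<^sup>2 \<le> 0"
      using norm_phase_fib_sq_le[OF Z _ _ that] assms sigma_F_gt by (simp add: eps_def)
    then show ?thesis by (simp add: add_eq_0_iff2)
  qed
  obtain k :: nat where k: "\<bar>Im s\<bar> < real k" using reals_Archimedean2 by blast
  \<comment> \<open>Odd n gives the sign +1 in Cassini's identity, n > 12 avoids the exceptional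
    index, and n >= k makes G exceed |Im s|.\<close>
  define n where "n = 2 * k + 13"
  define G where "G = real (fib (Suc n))"
  have "k \<le> fib (Suc n)" using le_fib_Suc[of n] by (simp add: n_def)
  then have G: "\<bar>Im s\<bar> < G" using k by (simp add: G_def)
  have G1: "1 \<le> G" using fib_neq_0_nat[of "Suc n"] by (simp add: G_def del: fib.simps)
  have cassini: "fib (Suc (Suc n)) * fib n = fib (Suc n) * fib (Suc n) + 1"
    using fib_Cassini_nat[of n] by (simp add: n_def power2_eq_square del: fib.simps)
  have pos: "0 < fib n" "0 < fib (Suc n)" "0 < fib (Suc (Suc n))"
    by (simp_all add: fib_neq_0_nat n_def del: fib.simps)
  have ph1: "phase (fib n) s = - 1" "phase (fib (Suc n)) s = - 1" "phase (fib (Suc (Suc n))) s = - 1"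
    by (intro ph; simp add: n_def)+
  have "phase (fib (Suc (Suc n)) * fib n) s = 1" "phase (fib (Suc n) * fib (Suc n)) s = 1"
    using pos ph1 by (simp_all add: phase_mult del: fib.simps)
  then have "cis (- (Im s * ln (real (fib (Suc (Suc n)) * fib n)))) = 1"
    "cis (- (Im s * ln (real (fib (Suc n) * fib (Suc n))))) = 1"
    using pos by (simp_all only: phase_eq_cis nat_0_less_mult_iff simp_thms)
  then have cis: "cis (- (Im s * ln (G * G + 1))) / cis (- (Im s * ln (G * G))) = 1"
    unfolding cassini by (simp add: G_def add.commute del: fib.simps)
  define d where "d = ln (G * G + 1) - ln (G * G)"
  have "0 < G * G" using G1 by simp
  moreover from this have "G * G + 1 \<noteq> 0" by linarith
  ultimately have "d = ln ((G * G + 1) / (G * G))"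
    by (simp add: d_def ln_div)
  also have "(G * G + 1) / (G * G) = 1 + 1 / (G * G)"
    using G1 by (simp add: add_divide_distrib)
  finally have "d = ln (1 + 1 / (G * G))" .
  moreover have "0 < 1 / (G * G)" using G1 by simp
  ultimately have d: "0 < d" "d \<le> 1 / (G * G)"
    using ln_add_one_self_le_self[of "1 / (G * G)"] ln_gt_zero[of "1 + 1 / (G * G)"] by auto
  have "cis (- (Im s * d)) = 1"
    using cis by (simp add: cis_divide d_def right_diff_distrib)
  then have "cos (Im s * d) = 1" by (simp add: complex_eq_iff)
  then obtain i :: int where i: "Im s * d = real_of_int i * 2 * pi"
    using cos_one_2pi_int by blast
  have "\<bar>Im s\<bar> * d \<le> G * (1 / (G * G))"
    using G d by (intro mult_mono) auto
  also have "\<dots> \<le> 1" using G1 by simp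
  finally have "\<bar>Im s * d\<bar> \<le> 1" using d by (simp add: abs_mult)
  then have i1: "\<bar>real_of_int i\<bar> * (2 * pi) \<le> 1"
    unfolding i by (simp add: abs_mult)
  have "i = 0"
  proof (rule ccontr)
    assume "i \<noteq> 0"
    then have "1 * (2 * pi) \<le> \<bar>real_of_int i\<bar> * (2 * pi)"
      by (intro mult_right_mono) auto
    then show False using i1 pi_gt3 by linarith
  qed
  then have "Im s = 0" using i d by simp
  then have "phase (fib 3) s = 1" by (simp add: phase_eq_cis fib_3_4_12)
  then show False using ph[of 3] by simp
qed

section \<open>Limits and rate along a sequence of zeros\<close>

text \<open>Monotone convergence gives only Re <= \<open>sigma_F\<close>; the absence of zeros on
  the line makes it strict.\<close>

lemma zeros_eventually:
  assumes "zeros_increasing_to_sigma_F \<rho>"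
  shows "eventually (\<lambda>j. Z_F (\<rho> j) = 0 \<and> 37 / 50 \<le> Re (\<rho> j) \<and> Re (\<rho> j) < sigma_F) sequentially"
proof -
  have Z: "Z_F (\<rho> j) = 0" and inc: "incseq (\<lambda>j. Re (\<rho> j))" and lim: "(\<lambda>j. Re (\<rho> j)) \<longlonglongrightarrow> sigma_F" for j
    using assms by (auto simp: zeros_increasing_to_sigma_F_def)
  have "Re (\<rho> j) < sigma_F" for j
    using incseq_le[OF inc lim, of j] Z_F_nonzero_on_line[of "\<rho> j"] Z[of j] by fastforce
  moreover have "eventually (\<lambda>j. 37 / 50 < Re (\<rho> j)) sequentially"
    using order_tendstoD(1)[OF lim sigma_F_gt] .
  ultimately show ?thesis
    using Z by (auto elim: eventually_mono)
qed

lemma eps_tendsto_0: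
  assumes "zeros_increasing_to_sigma_F \<rho>"
  shows "(\<lambda>j. eps (\<rho> j)) \<longlonglongrightarrow> 0"
proof -
  have "(\<lambda>j. Re (\<rho> j)) \<longlonglongrightarrow> sigma_F"
    using assms by (auto simp: zeros_increasing_to_sigma_F_def)
  from tendsto_diff[OF tendsto_const[of sigma_F] this] show ?thesis
    by (simp add: eps_def)
qed

lemma phase_fib_tendsto:
  assumes "zeros_increasing_to_sigma_F \<rho>" "3 \<le> n" "n \<noteq> 12"
  shows "(\<lambda>j. phase (fib n) (\<rho> j)) \<longlonglongrightarrow> - 1"
proof -
  have "(\<lambda>j. (norm (phase (fib n) (\<rho> j) + 1))\<^sup>2) \<longlonglongrightarrow> 0"
  proof (rule tendsto_sandwich[where f = "\<lambda>_. 0"])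
    show "eventually (\<lambda>j. (norm (phase (fib n) (\<rho> j) + 1))\<^sup>2 \<le>
        phase_const * real (fib n) powr sigma_F * eps (\<rho> j)) sequentially"
      using zeros_eventually[OF assms(1)]
      by (rule eventually_mono) (intro norm_phase_fib_sq_le assms; simp)
    show "(\<lambda>j. phase_const * real (fib n) powr sigma_F * eps (\<rho> j)) \<longlonglongrightarrow> 0"
      by (intro tendsto_mult_right_zero eps_tendsto_0 assms)
  qed auto
  then have "(\<lambda>j. sqrt ((norm (phase (fib n) (\<rho> j) + 1))\<^sup>2)) \<longlonglongrightarrow> sqrt 0"
    by (rule tendsto_real_sqrt)
  then have "(\<lambda>j. phase (fib n) (\<rho> j) - (- 1)) \<longlonglongrightarrow> 0"
    by (simp add: tendsto_norm_zero_iff)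
  then show ?thesis by (rule LIM_zero_cancel)
qed

text \<open>F_n <= phi^n and n <= c ln (1/eps) bound F_n^sigma_F by eps^(-c sigma_F ln phi).
  Multiplying by eps and taking the square root gives the exponent.\<close>

lemma norm_phase_fib_le:
  assumes s: "Z_F s = 0" "37 / 50 \<le> Re s" "Re s < sigma_F" and n: "n \<in> index_range c s"
  shows "norm (phase (fib n) s + 1) \<le>
    sqrt phase_const * eps s powr ((1 - c * sigma_F * ln phi) / 2)"
proof -
  have e: "0 < eps s" using s by (simp add: eps_def)
  have n': "3 \<le> n" "n \<noteq> 12" "real n \<le> c * ln (1 / eps s)"
    using n by (auto simp: index_range_def)
  have const: "0 \<le> phase_const"
    using fib_lipschitz_nonneg by (simp add: phase_const_def)
  have sq: "(eps s powr (a / 2))\<^sup>2 = eps s powr a" for a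
    by (simp add: power2_eq_square flip: powr_add)
  have "real (fib n) powr sigma_F \<le> (phi ^ n) powr sigma_F"
    using fib_le_phi_power[of n] sigma_F_gt by (intro powr_mono2) auto
  also have "\<dots> = exp (real n * (sigma_F * ln phi))"
    using phi_pos by (simp add: powr_def ln_realpow mult_ac)
  also have "\<dots> \<le> exp (c * ln (1 / eps s) * (sigma_F * ln phi))"
    using n'(3) phi_pos sigma_F_gt by (intro iffD2[OF exp_le_cancel_iff] mult_right_mono) auto
  also have "\<dots> = eps s powr (- (c * sigma_F * ln phi))"
    using e by (simp add: powr_def ln_div mult_ac)
  finally have F: "real (fib n) powr sigma_F \<le> eps s powr (- (c * sigma_F * ln phi))" .
  have "(norm (phase (fib n) s + 1))\<^sup>2 \<le> phase_const * real (fib n) powr sigma_F * eps s"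
    using s n' by (intro norm_phase_fib_sq_le) auto
  also have "\<dots> \<le> phase_const * eps s powr (- (c * sigma_F * ln phi)) * eps s"
    using F const e by (intro mult_right_mono mult_left_mono) auto
  also have "\<dots> = phase_const * (eps s * eps s powr (- (c * sigma_F * ln phi)))"
    by (simp only: mult_ac)
  also have "\<dots> = phase_const * eps s powr (1 - c * sigma_F * ln phi)"
    using e by (subst powr_mult_base) auto
  also have "\<dots> = (sqrt phase_const * eps s powr ((1 - c * sigma_F * ln phi) / 2))\<^sup>2"
    using const by (simp only: power_mult_distrib real_sqrt_pow2 sq)
  finally show ?thesis
    by (rule power2_le_imp_le) (use const in auto)
qed

text \<open>\<open>Max\<close> is meaningful only on finite nonempty sets; the threshold exp (-3/c)
  is where the index 3 enters the range.\<close>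

lemma index_range_finite_nonempty:
  assumes c: "0 < c" and e: "0 < eps s" "eps s \<le> exp (- (3 / c))"
  shows "finite (index_range c s)" "index_range c s \<noteq> {}"
proof -
  have "index_range c s \<subseteq> {..nat \<lceil>c * ln (1 / eps s)\<rceil>}"
  proof
    fix n assume "n \<in> index_range c s"
    then have "real n \<le> real (nat \<lceil>c * ln (1 / eps s)\<rceil>)"
      unfolding index_range_def using order_trans[OF _ real_nat_ceiling_ge] by blast
    then show "n \<in> {..nat \<lceil>c * ln (1 / eps s)\<rceil>}" by simp
  qed
  then show "finite (index_range c s)" by (rule finite_subset) simp
  have "ln (eps s) \<le> - (3 / c)" using e ln_le_cancel_iff[of "eps s" "exp (- (3 / c))"] by simp
  then have "3 \<in> index_range c s"
    using c e by (simp add: index_range_def ln_div field_simps)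
  then show "index_range c s \<noteq> {}" by auto
qed

theorem corollary7p2:
  shows "(\<forall>\<rho>. zeros_increasing_to_sigma_F \<rho> \<longrightarrow>
      (\<lambda>j. phase 2 (\<rho> j)) \<longlonglongrightarrow> - 1 \<and>
      (\<lambda>j. phase 3 (\<rho> j)) \<longlonglongrightarrow> - 1 \<and>
      (\<lambda>j. phase 8 (\<rho> j)) \<longlonglongrightarrow> - 1 \<and>
      (\<lambda>j. phase 144 (\<rho> j)) \<longlonglongrightarrow> 1 \<and>
      (\<forall>n\<ge>3. n \<noteq> 12 \<longrightarrow> (\<lambda>j. phase (fib n) (\<rho> j)) \<longlonglongrightarrow> - 1)) \<and>
    2.7962718895 \<le> 1 / (sigma_F * ln phi) \<and> 1 / (sigma_F * ln phi) < 2.7962718896 \<and>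
    (\<forall>c::real. 0 < c \<and> c < 1 / (sigma_F * ln phi) \<longrightarrow>
      (\<exists>K::real. \<forall>\<rho>. zeros_increasing_to_sigma_F \<rho> \<longrightarrow>
        (\<forall>\<^sub>F j in sequentially.
          Max ((\<lambda>n. norm (phase (fib n) (\<rho> j) + 1)) ` index_range c (\<rho> j))
            \<le> K * eps (\<rho> j) powr ((1 - c * sigma_F * ln phi) / 2))))"
proof (intro conjI allI impI exponent_bounds)
  fix \<rho> assume \<rho>: "zeros_increasing_to_sigma_F \<rho>"
  show two: "(\<lambda>j. phase 2 (\<rho> j)) \<longlonglongrightarrow> - 1"
    using phase_fib_tendsto[OF \<rho>, of 3] by (simp add: fib_3_4_12)
  show three: "(\<lambda>j. phase 3 (\<rho> j)) \<longlonglongrightarrow> - 1"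
    using phase_fib_tendsto[OF \<rho>, of 4] by (simp add: fib_3_4_12)
  show "(\<lambda>j. phase 8 (\<rho> j)) \<longlonglongrightarrow> - 1"
    using tendsto_power[OF two, of 3] by (simp add: phase_8)
  show "(\<lambda>j. phase 144 (\<rho> j)) \<longlonglongrightarrow> 1"
    using tendsto_mult[OF tendsto_power[OF two, of 4] tendsto_power[OF three, of 2]]
    by (simp add: phase_144)
  show "(\<lambda>j. phase (fib n) (\<rho> j)) \<longlonglongrightarrow> - 1" if "3 \<le> n" "n \<noteq> 12" for n
    using phase_fib_tendsto[OF \<rho> that] .
next
  fix c :: real assume c: "0 < c \<and> c < 1 / (sigma_F * ln phi)"
  \<comment> \<open>The constant \<open>sqrt phase_const\<close> is the same for all sequences; only
    the index from which the bound holds varies.\<close>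
  have "\<forall>\<^sub>F j in sequentially.
      Max ((\<lambda>n. norm (phase (fib n) (\<rho> j) + 1)) ` index_range c (\<rho> j))
        \<le> sqrt phase_const * eps (\<rho> j) powr ((1 - c * sigma_F * ln phi) / 2)"
    if \<rho>: "zeros_increasing_to_sigma_F \<rho>" for \<rho>
  proof -
    have "eventually (\<lambda>j. eps (\<rho> j) < exp (- (3 / c))) sequentially"
      by (rule order_tendstoD(2)[OF eps_tendsto_0[OF \<rho>]]) simp
    with zeros_eventually[OF \<rho>] show ?thesis
    proof eventually_elim
      case (elim j)
      then have "finite (index_range c (\<rho> j))" "index_range c (\<rho> j) \<noteq> {}"
        using c index_range_finite_nonempty[of c "\<rho> j"] by (simp_all add: eps_def)
      then show ?case
        using elim by (intro Max.boundedI) (auto intro: norm_phase_fib_le)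
    qed
  qed
  then show "\<exists>K::real. \<forall>\<rho>. zeros_increasing_to_sigma_F \<rho> \<longrightarrow>
        (\<forall>\<^sub>F j in sequentially.
          Max ((\<lambda>n. norm (phase (fib n) (\<rho> j) + 1)) ` index_range c (\<rho> j))
            \<le> K * eps (\<rho> j) powr ((1 - c * sigma_F * ln phi) / 2))"
    by blast
qed

end
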